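(* Let $n\ge 2$, let $A$ be an $n$-ary algebra over a field $k$, with $n$-ary product written $(a_1a_2\cdots a_n)$, and let $\mathcal{O}(A)=T(A)/I$, where $T(A)$ is the tensor algebra of the vector space $A$ and $I$ is the two-sided ideal generated by all elements $a_1\otimes\cdots\otimes a_n-(a_1a_2\cdots a_n)$ with $a_1,\dots,a_n\in A$. Let $i:A\to\mathcal{O}(A)$ be the canonical map (inclusion $A\subset T(A)$ followed by the projection). Let $M$ be a $\mathbb{Z}_{n-1}$-graded associative $k$-algebra, and let $M_1$ be the space of all its elements of degree $1$, which is an associative $n$-ary algebra under the $n$-fold product of $M$. If $\rho:A\to M_1\subset M$ is a homomorphism of $n$-ary algebras, then there exists a unique homomorphism of $\mathbb{Z}_{n-1}$-graded algebras $\tilde\rho:\mathcal{O}(A)\to M$ such that $\tilde\rho\circ i=\rho$.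
   Context: An $n$-ary algebra over a field $k$ is a $k$-vector space $A$ with a linear map $m:A^{\otimes n}\to A$, written $m(a_1\otimes\cdots\otimes a_n)=(a_1a_2\cdots a_n)$. A homomorphism of $n$-ary algebras is a linear map $f$ with $f((a_1\cdots a_n))=(f(a_1)\cdots f(a_n))$. An $n$-ary algebra is associative if the product of any $2n-1$ elements is uniquely defined, i.e. inserting $m$ in the $i$-th or in the $j$-th argument of $m$ gives the same map $A^{\otimes(2n-1)}\to A$ for all $1\le i,j\le n$. Here $T(A)=\bigoplus_{k\ge1}A^{\otimes k}$ is the (non-unital) tensor algebra, and $A$ is identified with $A^{\otimes 1}$. Algebras are not required to have a unit. $\mathbb{Z}_{n-1}=\mathbb{Z}/(n-1)\mathbb{Z}$. The generators of $I$ are homogeneous for the tensor degree modulo $n-1$, and $\mathcal{O}(A)$ carries the induced $\mathbb{Z}_{n-1}$-grading. A homomorphism of graded algebras is an algebra homomorphism preserving the degree. *)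

theory Defs
  imports "HOL-Algebra.Module" "HOL-Algebra.QuotRing" "HOL-Algebra.Elementary_Groups"
begin

section \<open>Vector spaces, linear maps, quotients\<close>

text \<open>
  A vector space over \<open>K\<close> is a \<^locale>\<open>module\<close> over \<open>K\<close>, with \<open>field K\<close> assumed where needed.
  The \<^locale>\<open>module\<close> locale constrains only the additive group and the scalar multiplication of the
  \<^type>\<open>module_ext\<close> record; for a mere vector space the fields \<open>mult\<close> and \<open>one\<close> are meaningless.
  Algebras use \<open>mult\<close>; since they need not be unital, \<open>one\<close> is never referred to.
\<close>

definition linear_maps ::
    "('k, 'x) ring_scheme \<Rightarrow> ('k, 'a, 'y) module_scheme \<Rightarrow> ('k, 'b, 'z) module_scheme \<Rightarrow> ('a \<Rightarrow> 'b) set"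
  where "linear_maps K V W =
    {f \<in> carrier V \<rightarrow> carrier W.
       (\<forall>x\<in>carrier V. \<forall>y\<in>carrier V. f (x \<oplus>\<^bsub>V\<^esub> y) = f x \<oplus>\<^bsub>W\<^esub> f y) \<and>
       (\<forall>c\<in>carrier K. \<forall>x\<in>carrier V. f (c \<odot>\<^bsub>V\<^esub> x) = c \<odot>\<^bsub>W\<^esub> f x)}"

definition gen_submodule ::
    "('k, 'x) ring_scheme \<Rightarrow> ('k, 'a, 'y) module_scheme \<Rightarrow> 'a set \<Rightarrow> 'a set"
  where "gen_submodule K V S = \<Inter>{H. submodule H K V \<and> S \<subseteq> H}"

text \<open>The coset ring \<^term>\<open>V Quot H\<close> of the library, with the induced scalar multiplication.
  It is used both for \<open>V\<close> a vector space and \<open>H\<close> a subspace, and for \<open>V\<close> an algebra and \<open>H\<close> an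
  algebra ideal.\<close>

definition quot_module :: "('k, 'a, 'y) module_scheme \<Rightarrow> 'a set \<Rightarrow> ('k, 'a set) module"
  where "quot_module V H =
    \<lparr>carrier = carrier (V Quot H), mult = mult (V Quot H), one = one (V Quot H),
     zero = zero (V Quot H), add = add (V Quot H),
     smult = (\<lambda>c X. \<Union>x\<in>X. H +>\<^bsub>V\<^esub> (c \<odot>\<^bsub>V\<^esub> x))\<rparr>"

definition free_module :: "('k, 'x) ring_scheme \<Rightarrow> 's set \<Rightarrow> ('k, 's \<Rightarrow> 'k) module"
  where "free_module K S =
    \<lparr>carrier = {f. (\<forall>s. f s \<in> carrier K) \<and> finite {s. f s \<noteq> \<zero>\<^bsub>K\<^esub>} \<and> {s. f s \<noteq> \<zero>\<^bsub>K\<^esub>} \<subseteq> S},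
     mult = undefined, one = undefined,
     zero = (\<lambda>s. \<zero>\<^bsub>K\<^esub>), add = (\<lambda>f g s. f s \<oplus>\<^bsub>K\<^esub> g s), smult = (\<lambda>c f s. c \<otimes>\<^bsub>K\<^esub> f s)\<rparr>"

definition free_basis :: "('k, 'x) ring_scheme \<Rightarrow> 's \<Rightarrow> ('s \<Rightarrow> 'k)"
  where "free_basis K s = (\<lambda>t. if t = s then \<one>\<^bsub>K\<^esub> else \<zero>\<^bsub>K\<^esub>)"


section \<open>Tensor powers\<close>

definition words :: "('k, 'a, 'y) module_scheme \<Rightarrow> nat \<Rightarrow> 'a list set"
  where "words A k = {w. length w = k \<and> set w \<subseteq> carrier A}"

definition multilinear_rels ::
    "('k, 'x) ring_scheme \<Rightarrow> ('k, 'a, 'y) module_scheme \<Rightarrow> nat \<Rightarrow> ('a list \<Rightarrow> 'k) set"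
  where "multilinear_rels K A k = (let F = free_module K (words A k); e = free_basis K in
    {e (u @ (a \<oplus>\<^bsub>A\<^esub> b) # v) \<ominus>\<^bsub>F\<^esub> (e (u @ a # v) \<oplus>\<^bsub>F\<^esub> e (u @ b # v)) | u v a b.
       u @ a # v \<in> words A k \<and> b \<in> carrier A} \<union>
    {e (u @ (c \<odot>\<^bsub>A\<^esub> a) # v) \<ominus>\<^bsub>F\<^esub> (c \<odot>\<^bsub>F\<^esub> e (u @ a # v)) | u v a c.
       u @ a # v \<in> words A k \<and> c \<in> carrier K})"

definition tensor_null ::
    "('k, 'x) ring_scheme \<Rightarrow> ('k, 'a, 'y) module_scheme \<Rightarrow> nat \<Rightarrow> ('a list \<Rightarrow> 'k) set"
  where "tensor_null K A k = gen_submodule K (free_module K (words A k)) (multilinear_rels K A k)"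

text \<open>\<open>tensor_power K A k\<close> is the \<open>k\<close>-th tensor power of \<open>A\<close>; \<open>pure_tensor K A [a\<^sub>1, \<dots>, a\<^sub>k]\<close> is
  \<open>a\<^sub>1 \<otimes> \<cdots> \<otimes> a\<^sub>k\<close>.\<close>

definition tensor_power ::
    "('k, 'x) ring_scheme \<Rightarrow> ('k, 'a, 'y) module_scheme \<Rightarrow> nat \<Rightarrow> ('k, ('a list \<Rightarrow> 'k) set) module"
  where "tensor_power K A k = quot_module (free_module K (words A k)) (tensor_null K A k)"

definition pure_tensor ::
    "('k, 'x) ring_scheme \<Rightarrow> ('k, 'a, 'y) module_scheme \<Rightarrow> 'a list \<Rightarrow> ('a list \<Rightarrow> 'k) set"
  where "pure_tensor K A w =
    tensor_null K A (length w) +>\<^bsub>free_module K (words A (length w))\<^esub> free_basis K w"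

text \<open>The concatenation map from (\<open>i\<close>-th power) times (\<open>j\<close>-th power) to the \<open>(i + j)\<close>-th power.
  On representatives \<open>f\<close>, \<open>g\<close> supported on words of lengths \<open>i\<close>, \<open>j\<close>, the coefficient of the
  product at \<open>w\<close> comes from the only possible splitting of \<open>w\<close>.\<close>

definition tensor_concat ::
    "('k, 'x) ring_scheme \<Rightarrow> ('k, 'a, 'y) module_scheme \<Rightarrow> nat \<Rightarrow> nat \<Rightarrow>
       ('a list \<Rightarrow> 'k) set \<Rightarrow> ('a list \<Rightarrow> 'k) set \<Rightarrow> ('a list \<Rightarrow> 'k) set"
  where "tensor_concat K A i j X Y =
    (\<Union>f\<in>X. \<Union>g\<in>Y. tensor_null K A (i + j) +>\<^bsub>free_module K (words A (i + j))\<^esub>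
        (\<lambda>w. f (take i w) \<otimes>\<^bsub>K\<^esub> g (drop i w)))"


section \<open>The non-unital tensor algebra\<close>

text \<open>Elements of the direct sum of the tensor powers with exponent \<open>k \<ge> 1\<close> are families
  of finite support, made extensional so that equality of families is equality of functions.\<close>

definition tensor_algebra ::
    "('k, 'x) ring_scheme \<Rightarrow> ('k, 'a, 'y) module_scheme \<Rightarrow> ('k, nat \<Rightarrow> ('a list \<Rightarrow> 'k) set) module"
  where "tensor_algebra K A =
    \<lparr>carrier = {x \<in> (\<Pi>\<^sub>E k\<in>{1..}. carrier (tensor_power K A k)).
                  finite {k\<in>{1..}. x k \<noteq> \<zero>\<^bsub>tensor_power K A k\<^esub>}},
     mult = (\<lambda>x y. \<lambda>k\<in>{1..}.
       \<Oplus>\<^bsub>tensor_power K A k\<^esub>i\<in>{1..<k}. tensor_concat K A i (k - i) (x i) (y (k - i))),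
     one = undefined,
     zero = (\<lambda>k\<in>{1..}. \<zero>\<^bsub>tensor_power K A k\<^esub>),
     add = (\<lambda>x y. \<lambda>k\<in>{1..}. x k \<oplus>\<^bsub>tensor_power K A k\<^esub> y k),
     smult = (\<lambda>c x. \<lambda>k\<in>{1..}. c \<odot>\<^bsub>tensor_power K A k\<^esub> x k)\<rparr>"

definition tensor_inj ::
    "('k, 'x) ring_scheme \<Rightarrow> ('k, 'a, 'y) module_scheme \<Rightarrow> 'a list \<Rightarrow> nat \<Rightarrow> ('a list \<Rightarrow> 'k) set"
  where "tensor_inj K A w =
    (\<lambda>k\<in>{1..}. if k = length w then pure_tensor K A w else \<zero>\<^bsub>tensor_power K A k\<^esub>)"


section \<open>Associative algebras, ideals, gradings\<close>

locale assoc_algebra = module K M for K (structure) and M (structure) +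
  assumes alg_mult_closed:
      "\<lbrakk>x \<in> carrier M; y \<in> carrier M\<rbrakk> \<Longrightarrow> x \<otimes>\<^bsub>M\<^esub> y \<in> carrier M"
    and alg_mult_assoc:
      "\<lbrakk>x \<in> carrier M; y \<in> carrier M; z \<in> carrier M\<rbrakk> \<Longrightarrow>
        (x \<otimes>\<^bsub>M\<^esub> y) \<otimes>\<^bsub>M\<^esub> z = x \<otimes>\<^bsub>M\<^esub> (y \<otimes>\<^bsub>M\<^esub> z)"
    and alg_l_distr:
      "\<lbrakk>x \<in> carrier M; y \<in> carrier M; z \<in> carrier M\<rbrakk> \<Longrightarrow>
        (x \<oplus>\<^bsub>M\<^esub> y) \<otimes>\<^bsub>M\<^esub> z = x \<otimes>\<^bsub>M\<^esub> z \<oplus>\<^bsub>M\<^esub> y \<otimes>\<^bsub>M\<^esub> z"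
    and alg_r_distr:
      "\<lbrakk>x \<in> carrier M; y \<in> carrier M; z \<in> carrier M\<rbrakk> \<Longrightarrow>
        z \<otimes>\<^bsub>M\<^esub> (x \<oplus>\<^bsub>M\<^esub> y) = z \<otimes>\<^bsub>M\<^esub> x \<oplus>\<^bsub>M\<^esub> z \<otimes>\<^bsub>M\<^esub> y"
    and alg_smult_l:
      "\<lbrakk>c \<in> carrier K; x \<in> carrier M; y \<in> carrier M\<rbrakk> \<Longrightarrow>
        (c \<odot>\<^bsub>M\<^esub> x) \<otimes>\<^bsub>M\<^esub> y = c \<odot>\<^bsub>M\<^esub> (x \<otimes>\<^bsub>M\<^esub> y)"
    and alg_smult_r:
      "\<lbrakk>c \<in> carrier K; x \<in> carrier M; y \<in> carrier M\<rbrakk> \<Longrightarrow>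
        x \<otimes>\<^bsub>M\<^esub> (c \<odot>\<^bsub>M\<^esub> y) = c \<odot>\<^bsub>M\<^esub> (x \<otimes>\<^bsub>M\<^esub> y)"

definition alg_ideal ::
    "('k, 'x) ring_scheme \<Rightarrow> ('k, 'a, 'y) module_scheme \<Rightarrow> 'a set \<Rightarrow> bool"
  where "alg_ideal K M I \<longleftrightarrow> submodule I K M \<and>
    (\<forall>x\<in>I. \<forall>y\<in>carrier M. x \<otimes>\<^bsub>M\<^esub> y \<in> I \<and> y \<otimes>\<^bsub>M\<^esub> x \<in> I)"

definition gen_alg_ideal ::
    "('k, 'x) ring_scheme \<Rightarrow> ('k, 'a, 'y) module_scheme \<Rightarrow> 'a set \<Rightarrow> 'a set"
  where "gen_alg_ideal K M S = \<Inter>{I. alg_ideal K M I \<and> S \<subseteq> I}"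

text \<open>\<open>G\<close> is the (commutative) grading group, \<open>gr g\<close> the set of all elements of degree \<open>g\<close>.\<close>

definition graded_algebra ::
    "('k, 'x) ring_scheme \<Rightarrow> ('g, 'z) monoid_scheme \<Rightarrow> ('k, 'a, 'y) module_scheme \<Rightarrow>
       ('g \<Rightarrow> 'a set) \<Rightarrow> bool"
  where "graded_algebra K G M gr \<longleftrightarrow>
    assoc_algebra K M \<and>
    (\<forall>g\<in>carrier G. submodule (gr g) K M) \<and>
    (\<forall>x\<in>carrier M. \<exists>!c. c \<in> (\<Pi>\<^sub>E g\<in>carrier G. gr g) \<and>
        finite {g\<in>carrier G. c g \<noteq> \<zero>\<^bsub>M\<^esub>} \<and>
        x = (\<Oplus>\<^bsub>M\<^esub>g\<in>{g\<in>carrier G. c g \<noteq> \<zero>\<^bsub>M\<^esub>}. c g)) \<and>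
    (\<forall>g\<in>carrier G. \<forall>h\<in>carrier G. \<forall>x\<in>gr g. \<forall>y\<in>gr h. x \<otimes>\<^bsub>M\<^esub> y \<in> gr (g \<otimes>\<^bsub>G\<^esub> h))"

definition graded_alg_homs ::
    "('k, 'x) ring_scheme \<Rightarrow> ('g, 'z) monoid_scheme \<Rightarrow>
       ('k, 'a, 'y) module_scheme \<Rightarrow> ('g \<Rightarrow> 'a set) \<Rightarrow>
       ('k, 'b, 'w) module_scheme \<Rightarrow> ('g \<Rightarrow> 'b set) \<Rightarrow> ('a \<Rightarrow> 'b) set"
  where "graded_alg_homs K G M gr N gr' =
    {f \<in> linear_maps K M N.
       (\<forall>x\<in>carrier M. \<forall>y\<in>carrier M. f (x \<otimes>\<^bsub>M\<^esub> y) = f x \<otimes>\<^bsub>N\<^esub> f y) \<and>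
       (\<forall>g\<in>carrier G. f ` gr g \<subseteq> gr' g)}"

text \<open>\<open>Z_class n k\<close> is the class of \<open>k\<close> in the integers modulo \<open>n - 1\<close>, as an element of
  \<^term>\<open>integer_mod_group (n - 1)\<close>; in particular \<open>Z_class 2 1 = 0\<close>.\<close>

definition Z_class :: "nat \<Rightarrow> nat \<Rightarrow> int"
  where "Z_class n k = int k mod int (n - 1)"


section \<open>\<open>n\<close>-ary algebras\<close>

text \<open>The \<open>n\<close>-ary product is given by its values \<open>br [a\<^sub>1, \<dots>, a\<^sub>n] = (a\<^sub>1 \<cdots> a\<^sub>n)\<close>; values of \<open>br\<close>
  on other lists are irrelevant.\<close>

definition nary_algebra ::
    "('k, 'x) ring_scheme \<Rightarrow> nat \<Rightarrow> ('k, 'a, 'y) module_scheme \<Rightarrow> ('a list \<Rightarrow> 'a) \<Rightarrow> bool"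
  where "nary_algebra K n A br \<longleftrightarrow> module K A \<and>
    (\<exists>m \<in> linear_maps K (tensor_power K A n) A. \<forall>w\<in>words A n. br w = m (pure_tensor K A w))"

definition nary_homs ::
    "('k, 'x) ring_scheme \<Rightarrow> nat \<Rightarrow> ('k, 'a, 'y) module_scheme \<Rightarrow> ('a list \<Rightarrow> 'a) \<Rightarrow>
       ('k, 'b, 'z) module_scheme \<Rightarrow> ('b list \<Rightarrow> 'b) \<Rightarrow> ('a \<Rightarrow> 'b) set"
  where "nary_homs K n A br B br' =
    {f \<in> linear_maps K A B. \<forall>w\<in>words A n. f (br w) = br' (map f w)}"

text \<open>The product of a nonempty list in an algebra without unit.\<close>

definition fold_mult :: "('k, 'a, 'y) module_scheme \<Rightarrow> 'a list \<Rightarrow> 'a"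
  where "fold_mult M w = foldr (\<lambda>x y. x \<otimes>\<^bsub>M\<^esub> y) (butlast w) (last w)"


section \<open>The enveloping algebra \<open>O(A)\<close>\<close>

definition env_ideal ::
    "('k, 'x) ring_scheme \<Rightarrow> nat \<Rightarrow> ('k, 'a, 'y) module_scheme \<Rightarrow> ('a list \<Rightarrow> 'a) \<Rightarrow>
       (nat \<Rightarrow> ('a list \<Rightarrow> 'k) set) set"
  where "env_ideal K n A br = gen_alg_ideal K (tensor_algebra K A)
    {tensor_inj K A w \<ominus>\<^bsub>tensor_algebra K A\<^esub> tensor_inj K A [br w] | w. w \<in> words A n}"

definition env_algebra ::
    "('k, 'x) ring_scheme \<Rightarrow> nat \<Rightarrow> ('k, 'a, 'y) module_scheme \<Rightarrow> ('a list \<Rightarrow> 'a) \<Rightarrow>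
       ('k, (nat \<Rightarrow> ('a list \<Rightarrow> 'k) set) set) module"
  where "env_algebra K n A br = quot_module (tensor_algebra K A) (env_ideal K n A br)"

definition env_proj ::
    "('k, 'x) ring_scheme \<Rightarrow> nat \<Rightarrow> ('k, 'a, 'y) module_scheme \<Rightarrow> ('a list \<Rightarrow> 'a) \<Rightarrow>
       (nat \<Rightarrow> ('a list \<Rightarrow> 'k) set) \<Rightarrow> (nat \<Rightarrow> ('a list \<Rightarrow> 'k) set) set"
  where "env_proj K n A br x = env_ideal K n A br +>\<^bsub>tensor_algebra K A\<^esub> x"

definition env_incl ::
    "('k, 'x) ring_scheme \<Rightarrow> nat \<Rightarrow> ('k, 'a, 'y) module_scheme \<Rightarrow> ('a list \<Rightarrow> 'a) \<Rightarrow>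
       'a \<Rightarrow> (nat \<Rightarrow> ('a list \<Rightarrow> 'k) set) set"
  where "env_incl K n A br a = env_proj K n A br (tensor_inj K A [a])"

text \<open>The grading induced by the tensor degree modulo \<open>n - 1\<close>.\<close>

definition tensor_grading ::
    "('k, 'x) ring_scheme \<Rightarrow> nat \<Rightarrow> ('k, 'a, 'y) module_scheme \<Rightarrow>
       int \<Rightarrow> (nat \<Rightarrow> ('a list \<Rightarrow> 'k) set) set"
  where "tensor_grading K n A d = {x \<in> carrier (tensor_algebra K A).
    \<forall>k\<ge>1. x k \<noteq> \<zero>\<^bsub>tensor_power K A k\<^esub> \<longrightarrow> Z_class n k = d}"

definition env_grading ::
    "('k, 'x) ring_scheme \<Rightarrow> nat \<Rightarrow> ('k, 'a, 'y) module_scheme \<Rightarrow> ('a list \<Rightarrow> 'a) \<Rightarrow>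
       int \<Rightarrow> (nat \<Rightarrow> ('a list \<Rightarrow> 'k) set) set set"
  where "env_grading K n A br d = env_proj K n A br ` tensor_grading K n A d"

end

(* A homogeneous word a_1 ... a_k goes to the product rho(a_1) ... rho(a_k) in M, which is multilinear
   and multiplicative under concatenation, hence an algebra homomorphism on T(A). It kills the
   generators of I because rho is a homomorphism of n-ary algebras, and it maps tensor degree k to
   degree k mod n - 1 because rho has values in degree 1. Uniqueness holds since A generates T(A). *)
theory Submission
  imports Defs
begin

section \<open>Linear maps, submodules and quotients\<close>

text \<open>T(A) is concrete here: an element of a tensor power is a coset of finitely supported
  functions on words, and products and scalar multiples are unions over representatives. Hence
  well-definedness is the main obstacle. Concatenation descends to cosets because putting a fixed
  word before or after a multilinearity relator gives another such relator; linearity extends this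
  to all factors. Maps out of the enveloping algebra come from a chain of universal properties: free
  module on words, quotient by the relators, direct sum of the powers, quotient by the ideal.
  Identities in T(A) are checked on words, through induction principles expressing that words span.
  Confining such an induction to words whose lengths lie in one residue class is what yields
  preservation of degrees. The modulus n - 1 is the one for which a word of length n and the single
  letter identified with it have the same degree.\<close>

lemma linear_mapsI:
  assumes "\<And>x. x \<in> carrier V \<Longrightarrow> f x \<in> carrier W"
    and "\<And>x y. x \<in> carrier V \<Longrightarrow> y \<in> carrier V \<Longrightarrow> f (x \<oplus>\<^bsub>V\<^esub> y) = f x \<oplus>\<^bsub>W\<^esub> f y"
    and "\<And>c x. c \<in> carrier K \<Longrightarrow> x \<in> carrier V \<Longrightarrow> f (c \<odot>\<^bsub>V\<^esub> x) = c \<odot>\<^bsub>W\<^esub> f x"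
  shows "f \<in> linear_maps K V W"
  using assms by (auto simp: linear_maps_def)

lemma linear_maps_closed: "f \<in> linear_maps K V W \<Longrightarrow> x \<in> carrier V \<Longrightarrow> f x \<in> carrier W"
  and linear_maps_add: "f \<in> linear_maps K V W \<Longrightarrow> x \<in> carrier V \<Longrightarrow> y \<in> carrier V \<Longrightarrow>
        f (x \<oplus>\<^bsub>V\<^esub> y) = f x \<oplus>\<^bsub>W\<^esub> f y"
  and linear_maps_smult: "f \<in> linear_maps K V W \<Longrightarrow> c \<in> carrier K \<Longrightarrow> x \<in> carrier V \<Longrightarrow>
        f (c \<odot>\<^bsub>V\<^esub> x) = c \<odot>\<^bsub>W\<^esub> f x"
  by (auto simp: linear_maps_def)

lemma linear_maps_compose:
  "f \<in> linear_maps K V W \<Longrightarrow> g \<in> linear_maps K W X \<Longrightarrow> (\<lambda>x. g (f x)) \<in> linear_maps K V X"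
  by (rule linear_mapsI) (auto simp: linear_maps_closed linear_maps_add linear_maps_smult)

lemma linear_maps_zero:
  assumes V: "module K V" and W: "module K W" and f: "f \<in> linear_maps K V W"
  shows "f \<zero>\<^bsub>V\<^esub> = \<zero>\<^bsub>W\<^esub>"
proof -
  interpret V: module K V by fact
  interpret W: module K W by fact
  have "f \<zero>\<^bsub>V\<^esub> = f (\<zero>\<^bsub>K\<^esub> \<odot>\<^bsub>V\<^esub> \<zero>\<^bsub>V\<^esub>)" by simp
  also have "\<dots> = \<zero>\<^bsub>K\<^esub> \<odot>\<^bsub>W\<^esub> f \<zero>\<^bsub>V\<^esub>" using f by (intro linear_maps_smult) auto
  finally show ?thesis using linear_maps_closed[OF f V.M.zero_closed] by simp
qed

lemma (in abelian_group) minus_eq_zero_iff: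
  assumes "x \<in> carrier G" "y \<in> carrier G"
  shows "x \<ominus> y = \<zero> \<longleftrightarrow> x = y"
proof
  assume "x \<ominus> y = \<zero>"
  moreover have "x = (x \<ominus> y) \<oplus> y" using assms by (simp add: minus_eq a_assoc l_neg)
  ultimately show "x = y" using assms by simp
qed (use assms in \<open>simp add: minus_eq r_neg\<close>)

lemma (in module) minus_eq_smult: "x \<in> carrier M \<Longrightarrow> \<ominus>\<^bsub>M\<^esub> x = (\<ominus> \<one>) \<odot>\<^bsub>M\<^esub> x"
  by (simp add: smult_l_minus)

text \<open>Negation is scaling by minus one, so closure under it follows from closure under
  scalars.\<close>

lemma (in module) submoduleI':
  assumes "H \<subseteq> carrier M" and "\<zero>\<^bsub>M\<^esub> \<in> H"
    and "\<And>a b. a \<in> H \<Longrightarrow> b \<in> H \<Longrightarrow> a \<oplus>\<^bsub>M\<^esub> b \<in> H"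
    and "\<And>c a. c \<in> carrier R \<Longrightarrow> a \<in> H \<Longrightarrow> c \<odot>\<^bsub>M\<^esub> a \<in> H"
  shows "submodule H R M"
  using assms by (intro submoduleI) (auto simp: minus_eq_smult subset_iff)

lemma (in module) submodule_zero: "submodule H R M \<Longrightarrow> \<zero>\<^bsub>M\<^esub> \<in> H"
  using subgroup.one_closed[OF submodule.axioms(1)] by fastforce

lemma linear_maps_minus:
  assumes V: "module K V" and W: "module K W" and f: "f \<in> linear_maps K V W"
    and x: "x \<in> carrier V" "y \<in> carrier V"
  shows "f (x \<ominus>\<^bsub>V\<^esub> y) = f x \<ominus>\<^bsub>W\<^esub> f y"
proof -
  interpret V: module K V by fact
  interpret W: module K W by fact
  show ?thesis
    using x by (simp add: V.M.minus_eq W.M.minus_eq V.minus_eq_smult W.minus_eq_smult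
        linear_maps_add[OF f] linear_maps_smult[OF f] linear_maps_closed[OF f])
qed

text \<open>Serves in two ways: with \<open>H\<close> the zero subspace it handles kernels, and with
  \<open>H\<close> a null space it shows that a linear map sending generators into a null space
  sends their whole span there.\<close>

lemma submodule_vimage:
  assumes V: "module K V" and W: "module K W" and f: "f \<in> linear_maps K V W"
    and H: "submodule H K W"
  shows "submodule {x \<in> carrier V. f x \<in> H} K V"
proof -
  interpret V: module K V by fact
  interpret W: module K W by fact
  show ?thesis
    by (rule V.submoduleI')
      (auto simp: linear_maps_zero[OF V W f] linear_maps_add[OF f] linear_maps_smult[OF f]
        W.submodule_zero[OF H] intro: W.submoduleE[OF H])
qed

lemma (in module) zero_submodule: "submodule {\<zero>\<^bsub>M\<^esub>} R M"
  by (rule submoduleI') auto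

lemma (in module) submodule_Inter:
  assumes "\<And>H. H \<in> C \<Longrightarrow> submodule H R M" and "C \<noteq> {}"
  shows "submodule (\<Inter>C) R M"
proof (rule submoduleI')
  show "\<Inter>C \<subseteq> carrier M" using assms submoduleE(1) by blast
  show "\<zero>\<^bsub>M\<^esub> \<in> \<Inter>C" using assms submodule_zero by blast
qed (auto intro: submoduleE[OF assms(1)])

lemma (in module) gen_submodule_submodule:
  "S \<subseteq> carrier M \<Longrightarrow> submodule (gen_submodule R M S) R M"
  unfolding gen_submodule_def using carrier_is_submodule by (intro submodule_Inter) auto

lemma gen_submodule_superset: "S \<subseteq> gen_submodule K V S"
  by (auto simp: gen_submodule_def)

lemma gen_submodule_least: "submodule H K V \<Longrightarrow> S \<subseteq> H \<Longrightarrow> gen_submodule K V S \<subseteq> H"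
  by (auto simp: gen_submodule_def)

text \<open>Module axioms are equations, so they pass along an operation-preserving surjection onto
  a structure about which nothing is known yet; the inverse of \<open>f x\<close> is the image of
  the inverse of \<open>x\<close>. Its purpose is to make coset structures into modules.\<close>

lemma module_image:
  assumes V: "module K V" and car: "carrier W = f ` carrier V"
    and add: "\<And>x y. x \<in> carrier V \<Longrightarrow> y \<in> carrier V \<Longrightarrow> f (x \<oplus>\<^bsub>V\<^esub> y) = f x \<oplus>\<^bsub>W\<^esub> f y"
    and smult: "\<And>c x. c \<in> carrier K \<Longrightarrow> x \<in> carrier V \<Longrightarrow> f (c \<odot>\<^bsub>V\<^esub> x) = c \<odot>\<^bsub>W\<^esub> f x"
    and zero: "f \<zero>\<^bsub>V\<^esub> = \<zero>\<^bsub>W\<^esub>"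
  shows "module K W"
proof -
  interpret V: module K V by fact
  show ?thesis
  proof (rule moduleI)
    show "cring K" by (rule V.R.cring_axioms)
    show "abelian_group W"
    proof (rule abelian_groupI)
      fix x assume "x \<in> carrier W"
      then obtain x' where x': "x' \<in> carrier V" "x = f x'" by (auto simp: car)
      then have "f (\<ominus>\<^bsub>V\<^esub> x') \<oplus>\<^bsub>W\<^esub> x = \<zero>\<^bsub>W\<^esub>"
        by (simp add: add[symmetric] zero[symmetric] V.M.l_neg)
      then show "\<exists>y\<in>carrier W. y \<oplus>\<^bsub>W\<^esub> x = \<zero>\<^bsub>W\<^esub>" using x' by (auto simp: car)
    qed (auto simp: car add[symmetric] zero[symmetric] V.M.a_ac)
  qed (auto simp: car add[symmetric] smult[symmetric] V.smult_l_distr V.smult_r_distr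
      V.smult_assoc1)
qed

text \<open>One coset calculus for two uses: tensor powers as quotients of free modules, and the
  enveloping algebra as a quotient of the tensor algebra.\<close>

locale quotient = V?: module K V for K (structure) and V (structure) +
  fixes H assumes sub: "submodule H K V"
begin

sublocale sub: abelian_subgroup H V
  using submodule.axioms(1)[OF sub] V.M.abelian_group_axioms
  by (intro abelian_subgroupI3 additive_subgroupI)

lemma coset_iff: "y \<in> carrier V \<Longrightarrow> x \<in> H +>\<^bsub>V\<^esub> y \<longleftrightarrow> x \<in> carrier V \<and> x \<ominus>\<^bsub>V\<^esub> y \<in> H"
  using sub.a_rcos_module[of y x] sub.a_elemrcos_carrier[of y x] by (auto simp: V.M.minus_eq)

lemma coset_cong:
  "x \<in> carrier V \<Longrightarrow> y \<in> carrier V \<Longrightarrow> x \<ominus>\<^bsub>V\<^esub> y \<in> H \<Longrightarrow> H +>\<^bsub>V\<^esub> x = H +>\<^bsub>V\<^esub> y"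
  using sub.a_repr_independence'[of x y] coset_iff[of y x] by metis

lemma quot_carrier: "carrier (quot_module V H) = (\<lambda>x. H +>\<^bsub>V\<^esub> x) ` carrier V"
  by (auto simp: quot_module_def FactRing_def A_RCOSETS_def')

lemma quot_add: "x \<in> carrier V \<Longrightarrow> y \<in> carrier V \<Longrightarrow>
    (H +>\<^bsub>V\<^esub> x) \<oplus>\<^bsub>quot_module V H\<^esub> (H +>\<^bsub>V\<^esub> y) = H +>\<^bsub>V\<^esub> (x \<oplus>\<^bsub>V\<^esub> y)"
  by (simp add: quot_module_def FactRing_def sub.a_rcos_sum)

lemma quot_zero: "\<zero>\<^bsub>quot_module V H\<^esub> = H +>\<^bsub>V\<^esub> \<zero>\<^bsub>V\<^esub>"
  using sub.a_subset by (simp add: quot_module_def FactRing_def)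

text \<open>Scalar multiplication on the quotient is a union over all representatives. The union
  collapses to one coset once its members do not depend on the representative; the coset is nonempty
  since it contains \<open>x\<close>.\<close>

lemma coset_UN:
  assumes "x \<in> carrier V" and "\<And>y. y \<in> H +>\<^bsub>V\<^esub> x \<Longrightarrow> F y = F x"
  shows "(\<Union>y\<in>H +>\<^bsub>V\<^esub> x. F y) = F x"
  using assms sub.a_rcos_self by blast

lemma quot_smult:
  assumes c: "c \<in> carrier K" and x: "x \<in> carrier V"
  shows "c \<odot>\<^bsub>quot_module V H\<^esub> (H +>\<^bsub>V\<^esub> x) = H +>\<^bsub>V\<^esub> (c \<odot>\<^bsub>V\<^esub> x)"
proof -
  have "H +>\<^bsub>V\<^esub> (c \<odot>\<^bsub>V\<^esub> y) = H +>\<^bsub>V\<^esub> (c \<odot>\<^bsub>V\<^esub> x)" if y: "y \<in> H +>\<^bsub>V\<^esub> x" for y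
  proof (rule coset_cong)
    have yV: "y \<in> carrier V" and d: "y \<ominus>\<^bsub>V\<^esub> x \<in> H" using y x coset_iff by auto
    have "c \<odot>\<^bsub>V\<^esub> y \<ominus>\<^bsub>V\<^esub> c \<odot>\<^bsub>V\<^esub> x = c \<odot>\<^bsub>V\<^esub> (y \<ominus>\<^bsub>V\<^esub> x)"
      using c x yV by (simp add: V.M.minus_eq smult_r_distr smult_r_minus)
    then show "c \<odot>\<^bsub>V\<^esub> y \<ominus>\<^bsub>V\<^esub> c \<odot>\<^bsub>V\<^esub> x \<in> H" using submoduleE(4)[OF sub c d] by simp
    show "c \<odot>\<^bsub>V\<^esub> y \<in> carrier V" "c \<odot>\<^bsub>V\<^esub> x \<in> carrier V" using c x yV by auto
  qed
  then show ?thesis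
    unfolding quot_module_def using coset_UN[OF x, of "\<lambda>y. H +>\<^bsub>V\<^esub> (c \<odot>\<^bsub>V\<^esub> y)"] by simp
qed

lemma quot_is_module: "module K (quot_module V H)"
  by (rule module_image[OF V.module_axioms quot_carrier])
    (simp_all add: quot_add quot_smult quot_zero)

lemma quot_proj_linear: "(\<lambda>x. H +>\<^bsub>V\<^esub> x) \<in> linear_maps K V (quot_module V H)"
  by (rule linear_mapsI) (auto simp: quot_carrier quot_add quot_smult)

lemma quot_lift:
  assumes W: "module K W" and f: "f \<in> linear_maps K V W" and H: "\<And>h. h \<in> H \<Longrightarrow> f h = \<zero>\<^bsub>W\<^esub>"
  obtains g where "g \<in> linear_maps K (quot_module V H) W"
    and "\<And>x. x \<in> carrier V \<Longrightarrow> g (H +>\<^bsub>V\<^esub> x) = f x"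
proof -
  interpret W: module K W by fact
  \<comment> \<open>Evaluation at an arbitrarily chosen representative; two representatives differ
    by an element of \<open>H\<close>, which \<open>f\<close> kills.\<close>
  define g where "g = (\<lambda>X. f (SOME x. x \<in> X))"
  have g: "g (H +>\<^bsub>V\<^esub> x) = f x" if x: "x \<in> carrier V" for x
  proof -
    define y where "y = (SOME y. y \<in> H +>\<^bsub>V\<^esub> x)"
    have "y \<in> H +>\<^bsub>V\<^esub> x" unfolding y_def using sub.a_rcos_self[OF x] by (rule someI)
    then have y: "y \<in> carrier V" "y \<ominus>\<^bsub>V\<^esub> x \<in> H" using coset_iff x by auto
    have "f y \<ominus>\<^bsub>W\<^esub> f x = \<zero>\<^bsub>W\<^esub>"
      using linear_maps_minus[OF V.module_axioms W f y(1) x] H[OF y(2)] by simp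
    then have "f y = f x" using linear_maps_closed[OF f] x y W.M.minus_eq_zero_iff by blast
    then show ?thesis by (simp add: g_def y_def)
  qed
  have "g \<in> linear_maps K (quot_module V H) W"
    by (rule linear_mapsI) (auto simp: quot_carrier quot_add quot_smult g linear_maps_closed[OF f]
        linear_maps_add[OF f] linear_maps_smult[OF f])
  then show ?thesis using g that by blast
qed

end

lemma quotientI: "module K V \<Longrightarrow> submodule H K V \<Longrightarrow> quotient K V H"
  by (simp add: quotient_def quotient_axioms_def)


section \<open>Free modules\<close>

context
  fixes K :: "('k, 'x) ring_scheme"
  assumes K: "cring K"
begin

interpretation K: cring K by (rule K)

lemma free_carrier_iff: "f \<in> carrier (free_module K S) \<longleftrightarrow>
    (\<forall>s. f s \<in> carrier K) \<and> finite {s. f s \<noteq> \<zero>\<^bsub>K\<^esub>} \<and> {s. f s \<noteq> \<zero>\<^bsub>K\<^esub>} \<subseteq> S"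
  by (simp add: free_module_def)

lemma free_module_simps:
  "f \<oplus>\<^bsub>free_module K S\<^esub> g = (\<lambda>s. f s \<oplus>\<^bsub>K\<^esub> g s)" "c \<odot>\<^bsub>free_module K S\<^esub> f = (\<lambda>s. c \<otimes>\<^bsub>K\<^esub> f s)"
  "\<zero>\<^bsub>free_module K S\<^esub> = (\<lambda>s. \<zero>\<^bsub>K\<^esub>)"
  by (simp_all add: free_module_def)

lemma free_carrier_coeff: "f \<in> carrier (free_module K S) \<Longrightarrow> f s \<in> carrier K"
  by (simp add: free_carrier_iff)

lemma free_add_closed:
  assumes "f \<in> carrier (free_module K S)" "g \<in> carrier (free_module K S)"
  shows "(\<lambda>s. f s \<oplus>\<^bsub>K\<^esub> g s) \<in> carrier (free_module K S)"
proof -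
  have "{s. f s \<oplus>\<^bsub>K\<^esub> g s \<noteq> \<zero>\<^bsub>K\<^esub>} \<subseteq> {s. f s \<noteq> \<zero>\<^bsub>K\<^esub>} \<union> {s. g s \<noteq> \<zero>\<^bsub>K\<^esub>}" by auto
  then show ?thesis using assms unfolding free_carrier_iff
    by (auto intro: finite_subset)
qed

lemma free_smult_closed:
  assumes "c \<in> carrier K" "f \<in> carrier (free_module K S)"
  shows "(\<lambda>s. c \<otimes>\<^bsub>K\<^esub> f s) \<in> carrier (free_module K S)"
proof -
  have "{s. c \<otimes>\<^bsub>K\<^esub> f s \<noteq> \<zero>\<^bsub>K\<^esub>} \<subseteq> {s. f s \<noteq> \<zero>\<^bsub>K\<^esub>}" using assms by auto
  then show ?thesis using assms unfolding free_carrier_iff by (auto intro: finite_subset)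
qed

lemma free_is_module: "module K (free_module K S)"
proof (rule moduleI[OF K])
  show "abelian_group (free_module K S)"
  proof (rule abelian_groupI)
    fix f assume f: "f \<in> carrier (free_module K S)"
    then have "(\<lambda>s. \<ominus>\<^bsub>K\<^esub> \<one>\<^bsub>K\<^esub> \<otimes>\<^bsub>K\<^esub> f s) \<in> carrier (free_module K S)" by (intro free_smult_closed) auto
    moreover have "(\<lambda>s. \<ominus>\<^bsub>K\<^esub> \<one>\<^bsub>K\<^esub> \<otimes>\<^bsub>K\<^esub> f s) \<oplus>\<^bsub>free_module K S\<^esub> f = \<zero>\<^bsub>free_module K S\<^esub>"
      using f by (auto simp: free_module_simps free_carrier_coeff K.l_minus K.l_neg)
    ultimately show "\<exists>g\<in>carrier (free_module K S). g \<oplus>\<^bsub>free_module K S\<^esub> f = \<zero>\<^bsub>free_module K S\<^esub>" by blast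
  qed (auto simp: free_module_simps free_add_closed free_carrier_coeff K.a_ac
      free_carrier_iff[of "\<lambda>s. \<zero>\<^bsub>K\<^esub>"])
qed (auto simp: free_module_simps free_smult_closed free_carrier_coeff K.l_distr K.r_distr K.m_assoc)

lemma free_basis_closed: "s \<in> S \<Longrightarrow> free_basis K s \<in> carrier (free_module K S)"
proof -
  have "{t. free_basis K s t \<noteq> \<zero>\<^bsub>K\<^esub>} \<subseteq> {s}" by (auto simp: free_basis_def)
  then show "s \<in> S \<Longrightarrow> ?thesis" unfolding free_carrier_iff
    by (auto intro: finite_subset simp: free_basis_def)
qed

text \<open>Finite linear combinations of basis functions exhaust the free module. The induction
  runs over a finite set containing the support rather than over the support itself, so points with
  zero coefficient are harmless.\<close>

lemma free_induct:
  assumes f: "f \<in> carrier (free_module K S)"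
    and zero: "P \<zero>\<^bsub>free_module K S\<^esub>"
    and basis: "\<And>s. s \<in> S \<Longrightarrow> P (free_basis K s)"
    and add: "\<And>f g. f \<in> carrier (free_module K S) \<Longrightarrow> g \<in> carrier (free_module K S) \<Longrightarrow>
        P f \<Longrightarrow> P g \<Longrightarrow> P (f \<oplus>\<^bsub>free_module K S\<^esub> g)"
    and smult: "\<And>c f. c \<in> carrier K \<Longrightarrow> f \<in> carrier (free_module K S) \<Longrightarrow> P f \<Longrightarrow>
        P (c \<odot>\<^bsub>free_module K S\<^esub> f)"
  shows "P f"
proof -
  have "P f" if "finite T" "f \<in> carrier (free_module K S)" "{s. f s \<noteq> \<zero>\<^bsub>K\<^esub>} \<subseteq> T" for T f
    using that
  proof (induction T arbitrary: f rule: finite_induct)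
    case empty
    then have "f = \<zero>\<^bsub>free_module K S\<^esub>" by (auto simp: free_module_simps)
    then show ?case using zero by simp
  next
    case (insert t T)
    show ?case
    proof (cases "f t = \<zero>\<^bsub>K\<^esub>")
      case True
      then have "{s. f s \<noteq> \<zero>\<^bsub>K\<^esub>} \<subseteq> T" using insert.prems by auto
      then show ?thesis using insert.IH insert.prems by blast
    next
      case False
      \<comment> \<open>Erasing the coefficient at \<open>t\<close> leaves a function supported in
        \<open>T\<close>, and \<open>f\<close> is recovered by adding the multiple
        \<open>f t\<close> of the basis function at \<open>t\<close>.\<close>
      define g where "g = f(t := \<zero>\<^bsub>K\<^esub>)"
      have tS: "t \<in> S" using False insert.prems(1) by (auto simp: free_carrier_iff)
      have sub: "{s. g s \<noteq> \<zero>\<^bsub>K\<^esub>} \<subseteq> {s. f s \<noteq> \<zero>\<^bsub>K\<^esub>} - {t}" by (auto simp: g_def)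
      have g: "g \<in> carrier (free_module K S)"
        using insert.prems(1) sub unfolding free_carrier_iff
        by (auto intro: finite_subset simp: g_def)
      have ft: "f t \<in> carrier K" using insert.prems(1) by (rule free_carrier_coeff)
      have e: "free_basis K t \<in> carrier (free_module K S)" using tS by (rule free_basis_closed)
      have "P g" using insert.IH[OF g] sub insert.prems(2) by blast
      then have "P ((f t \<odot>\<^bsub>free_module K S\<^esub> free_basis K t) \<oplus>\<^bsub>free_module K S\<^esub> g)"
        using e ft g tS basis
        by (intro add smult module.smult_closed[OF free_is_module]) auto
      also have "(f t \<odot>\<^bsub>free_module K S\<^esub> free_basis K t) \<oplus>\<^bsub>free_module K S\<^esub> g = f"
        using ft insert.prems(1)
        by (auto simp: free_module_simps g_def free_basis_def free_carrier_coeff)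
      finally show ?thesis .
    qed
  qed
  from this[of "{s. f s \<noteq> \<zero>\<^bsub>K\<^esub>}" f] show ?thesis using f by (auto simp: free_carrier_iff)
qed

lemma free_lift:
  assumes W: "module K W" and \<phi>: "\<And>s. s \<in> S \<Longrightarrow> \<phi> s \<in> carrier W"
  obtains g where "g \<in> linear_maps K (free_module K S) W" and "\<And>s. s \<in> S \<Longrightarrow> g (free_basis K s) = \<phi> s"
proof -
  interpret W: module K W by fact
  define g where "g = (\<lambda>f. \<Oplus>\<^bsub>W\<^esub>s\<in>{s. f s \<noteq> \<zero>\<^bsub>K\<^esub>}. f s \<odot>\<^bsub>W\<^esub> \<phi> s)"
  \<comment> \<open>The defining sum may be enlarged from the support to any finite \<open>T\<close>
    inside \<open>S\<close>, the extra terms being zero. This gives two functions and their sum a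
    common index set.\<close>
  have g: "g f = (\<Oplus>\<^bsub>W\<^esub>s\<in>T. f s \<odot>\<^bsub>W\<^esub> \<phi> s)"
    if "f \<in> carrier (free_module K S)" "finite T" "{s. f s \<noteq> \<zero>\<^bsub>K\<^esub>} \<subseteq> T" "T \<subseteq> S" for f T
    unfolding g_def using that \<phi>
    by (intro W.add.finprod_mono_neutral_cong_left) (auto simp: free_carrier_iff subset_iff)
  have lin: "g \<in> linear_maps K (free_module K S) W"
  proof (rule linear_mapsI)
    fix f assume f: "f \<in> carrier (free_module K S)"
    then show "g f \<in> carrier W" unfolding g_def using \<phi>
      by (intro W.M.finsum_closed) (auto simp: free_carrier_iff)
    fix h assume h: "h \<in> carrier (free_module K S)"
    let ?T = "{s. f s \<noteq> \<zero>\<^bsub>K\<^esub>} \<union> {s. h s \<noteq> \<zero>\<^bsub>K\<^esub>}"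
    have T: "finite ?T" "?T \<subseteq> S" using f h by (auto simp: free_carrier_iff)
    have "g (\<lambda>s. f s \<oplus>\<^bsub>K\<^esub> h s) = (\<Oplus>\<^bsub>W\<^esub>s\<in>?T. (f s \<oplus>\<^bsub>K\<^esub> h s) \<odot>\<^bsub>W\<^esub> \<phi> s)"
      by (rule g[OF free_add_closed[OF f h] T(1) _ T(2)]) auto
    also have "\<dots> = (\<Oplus>\<^bsub>W\<^esub>s\<in>?T. f s \<odot>\<^bsub>W\<^esub> \<phi> s \<oplus>\<^bsub>W\<^esub> h s \<odot>\<^bsub>W\<^esub> \<phi> s)"
      using T \<phi> f h by (intro W.M.finsum_cong') (auto simp: free_carrier_coeff W.smult_l_distr subset_iff)
    also have "\<dots> = (\<Oplus>\<^bsub>W\<^esub>s\<in>?T. f s \<odot>\<^bsub>W\<^esub> \<phi> s) \<oplus>\<^bsub>W\<^esub> (\<Oplus>\<^bsub>W\<^esub>s\<in>?T. h s \<odot>\<^bsub>W\<^esub> \<phi> s)"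
      using T \<phi> f h by (intro W.M.finsum_addf) (auto simp: free_carrier_coeff subset_iff)
    also have "\<dots> = g f \<oplus>\<^bsub>W\<^esub> g h" using g[OF f T(1) _ T(2)] g[OF h T(1) _ T(2)] by simp
    finally show "g (f \<oplus>\<^bsub>free_module K S\<^esub> h) = g f \<oplus>\<^bsub>W\<^esub> g h" by (simp add: free_module_simps)
  next
    fix c f assume c: "c \<in> carrier K" and f: "f \<in> carrier (free_module K S)"
    let ?T = "{s. f s \<noteq> \<zero>\<^bsub>K\<^esub>}"
    have T: "finite ?T" "?T \<subseteq> S" using f by (auto simp: free_carrier_iff)
    have "g (\<lambda>s. c \<otimes>\<^bsub>K\<^esub> f s) = (\<Oplus>\<^bsub>W\<^esub>s\<in>?T. (c \<otimes>\<^bsub>K\<^esub> f s) \<odot>\<^bsub>W\<^esub> \<phi> s)"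
      using c by (intro g[OF free_smult_closed[OF c f] T(1) _ T(2)]) auto
    also have "\<dots> = (\<Oplus>\<^bsub>W\<^esub>s\<in>?T. c \<odot>\<^bsub>W\<^esub> (f s \<odot>\<^bsub>W\<^esub> \<phi> s))"
      using T \<phi> f c by (intro W.M.finsum_cong') (auto simp: free_carrier_coeff W.smult_assoc1 subset_iff)
    also have "\<dots> = c \<odot>\<^bsub>W\<^esub> g f"
      unfolding g_def using T \<phi> f c
      by (intro W.finsum_smult_ldistr[symmetric]) (auto simp: free_carrier_coeff subset_iff)
    finally show "g (c \<odot>\<^bsub>free_module K S\<^esub> f) = c \<odot>\<^bsub>W\<^esub> g f" by (simp add: free_module_simps)
  qed
  have "g (free_basis K s) = \<phi> s" if "s \<in> S" for s
  proof -
    have "g (free_basis K s) = (\<Oplus>\<^bsub>W\<^esub>t\<in>{s}. free_basis K s t \<odot>\<^bsub>W\<^esub> \<phi> t)"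
      using that by (intro g free_basis_closed) (auto simp: free_basis_def)
    then show ?thesis using \<phi>[OF that] by (simp add: free_basis_def)
  qed
  then show ?thesis using lin that by blast
qed

end


section \<open>Tensor powers\<close>

locale tensors = A?: module K A for K (structure) and A (structure)
begin

abbreviation F where "F k \<equiv> free_module K (words A k)"
abbreviation N where "N k \<equiv> tensor_null K A k"
abbreviation TP where "TP k \<equiv> tensor_power K A k"
abbreviation cls where "cls k f \<equiv> N k +>\<^bsub>F k\<^esub> f"

text \<open>The representative-level product inside \<open>tensor_concat\<close>, isolated so that
  bilinearity and compatibility with the null spaces can be proved before passing to cosets.\<close>

definition conv :: "nat \<Rightarrow> ('c list \<Rightarrow> 'a) \<Rightarrow> ('c list \<Rightarrow> 'a) \<Rightarrow> 'c list \<Rightarrow> 'a"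
  where "conv i f g = (\<lambda>w. f (take i w) \<otimes>\<^bsub>K\<^esub> g (drop i w))"

lemma words_iff: "w \<in> words A k \<longleftrightarrow> length w = k \<and> set w \<subseteq> carrier A"
  by (simp add: words_def)

lemma F_module: "module K (F k)"
  by (rule free_is_module[OF A.R.is_cring])

lemma F_basis_closed: "w \<in> words A k \<Longrightarrow> free_basis K w \<in> carrier (F k)"
  by (rule free_basis_closed[OF A.R.is_cring])

lemmas F_induct [consumes 1, case_names zero basis add smult] =
  free_induct[OF A.R.is_cring, where S = "words A k" for k]

text \<open>Beyond the shape of a relator, each case records that all words occurring in it have
  letters in \<open>A\<close>, which is what evaluating a map on the relator requires.\<close>

lemma multilinear_rels_cases [consumes 1, case_names add smult]:
  assumes "r \<in> multilinear_rels K A k"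
  obtains (add) u a b v where "u @ a # v \<in> words A k" "u @ b # v \<in> words A k"
      "u @ (a \<oplus>\<^bsub>A\<^esub> b) # v \<in> words A k"
      "r = free_basis K (u @ (a \<oplus>\<^bsub>A\<^esub> b) # v) \<ominus>\<^bsub>F k\<^esub>
        (free_basis K (u @ a # v) \<oplus>\<^bsub>F k\<^esub> free_basis K (u @ b # v))"
    | (smult) u a c v where "u @ a # v \<in> words A k" "u @ (c \<odot>\<^bsub>A\<^esub> a) # v \<in> words A k"
      "c \<in> carrier K"
      "r = free_basis K (u @ (c \<odot>\<^bsub>A\<^esub> a) # v) \<ominus>\<^bsub>F k\<^esub> (c \<odot>\<^bsub>F k\<^esub> free_basis K (u @ a # v))"
  using assms unfolding multilinear_rels_def Let_def
proof (elim UnE, goal_cases)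
  case 1
  from 1(3) obtain u v a b where *: "u @ a # v \<in> words A k" "b \<in> carrier A"
      "r = free_basis K (u @ (a \<oplus>\<^bsub>A\<^esub> b) # v) \<ominus>\<^bsub>F k\<^esub>
        (free_basis K (u @ a # v) \<oplus>\<^bsub>F k\<^esub> free_basis K (u @ b # v))" by blast
  show ?case by (rule 1(1)[OF *(1) _ _ *(3)]) (use * in \<open>auto simp: words_iff\<close>)
next
  case 2
  from 2(3) obtain u v a c where *: "u @ a # v \<in> words A k" "c \<in> carrier K"
      "r = free_basis K (u @ (c \<odot>\<^bsub>A\<^esub> a) # v) \<ominus>\<^bsub>F k\<^esub> (c \<odot>\<^bsub>F k\<^esub> free_basis K (u @ a # v))" by blast
  show ?case by (rule 2(2)[OF *(1) _ *(2,3)]) (use * in \<open>auto simp: words_iff\<close>)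
qed

lemma multilinear_rels_add:
  "u @ a # v \<in> words A k \<Longrightarrow> b \<in> carrier A \<Longrightarrow>
    free_basis K (u @ (a \<oplus>\<^bsub>A\<^esub> b) # v) \<ominus>\<^bsub>F k\<^esub>
      (free_basis K (u @ a # v) \<oplus>\<^bsub>F k\<^esub> free_basis K (u @ b # v)) \<in> multilinear_rels K A k"
  unfolding multilinear_rels_def Let_def by blast

lemma multilinear_rels_smult:
  "u @ a # v \<in> words A k \<Longrightarrow> c \<in> carrier K \<Longrightarrow>
    free_basis K (u @ (c \<odot>\<^bsub>A\<^esub> a) # v) \<ominus>\<^bsub>F k\<^esub> (c \<odot>\<^bsub>F k\<^esub> free_basis K (u @ a # v))
      \<in> multilinear_rels K A k"
  unfolding multilinear_rels_def Let_def by blast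

lemma multilinear_rels_closed: "multilinear_rels K A k \<subseteq> carrier (F k)"
proof
  interpret F: module K "F k" by (rule F_module)
  fix r assume "r \<in> multilinear_rels K A k"
  then show "r \<in> carrier (F k)"
    by (cases rule: multilinear_rels_cases) (auto intro!: F.M.minus_closed F.M.a_closed F_basis_closed)
qed

lemma N_quotient: "quotient K (F k) (N k)"
  unfolding tensor_null_def
  by (intro quotientI F_module module.gen_submodule_submodule multilinear_rels_closed)

lemma N_rels: "multilinear_rels K A k \<subseteq> N k"
  unfolding tensor_null_def by (rule gen_submodule_superset)

lemma N_submodule: "submodule (N k) K (F k)"
  by (rule quotient.sub[OF N_quotient])

lemma TP_module: "module K (TP k)"
  unfolding tensor_power_def by (rule quotient.quot_is_module[OF N_quotient])

lemmas TP_carrier = quotient.quot_carrier[OF N_quotient, folded tensor_power_def]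
  and TP_add = quotient.quot_add[OF N_quotient, folded tensor_power_def]
  and TP_smult = quotient.quot_smult[OF N_quotient, folded tensor_power_def]
  and TP_zero = quotient.quot_zero[OF N_quotient, folded tensor_power_def]

lemma pure_tensor_eq: "w \<in> words A k \<Longrightarrow> pure_tensor K A w = cls k (free_basis K w)"
  by (simp add: pure_tensor_def words_iff)

lemma pure_tensor_closed: "w \<in> words A k \<Longrightarrow> pure_tensor K A w \<in> carrier (TP k)"
  by (auto simp: pure_tensor_eq TP_carrier F_basis_closed)

text \<open>Pure tensors span: induction on a representative in the free module, whose basis
  functions project to pure tensors.\<close>

lemma tensor_power_induct [consumes 1, case_names zero pure add smult]:
  assumes X: "X \<in> carrier (TP k)"
    and zero: "P \<zero>\<^bsub>TP k\<^esub>"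
    and pure: "\<And>w. w \<in> words A k \<Longrightarrow> P (pure_tensor K A w)"
    and add: "\<And>X Y. X \<in> carrier (TP k) \<Longrightarrow> Y \<in> carrier (TP k) \<Longrightarrow> P X \<Longrightarrow> P Y \<Longrightarrow> P (X \<oplus>\<^bsub>TP k\<^esub> Y)"
    and smult: "\<And>c X. c \<in> carrier K \<Longrightarrow> X \<in> carrier (TP k) \<Longrightarrow> P X \<Longrightarrow> P (c \<odot>\<^bsub>TP k\<^esub> X)"
  shows "P X"
proof -
  obtain f where f: "f \<in> carrier (F k)" "X = cls k f" using X by (auto simp: TP_carrier)
  from f(1) have "P (cls k f)"
  proof (induction rule: F_induct)
    case zero then show ?case using assms(2) by (simp add: TP_zero)
  next
    case (basis s) then show ?case using pure[of s] by (simp add: pure_tensor_eq)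
  next
    case (add f g) then show ?case
      using assms(4)[of "cls k f" "cls k g"] by (auto simp: TP_add TP_carrier)
  next
    case (smult c f) then show ?case
      using assms(5)[of c "cls k f"] by (auto simp: TP_smult TP_carrier)
  qed
  then show ?thesis using f by simp
qed

text \<open>Universal property of the tensor power. The linear extension of \<open>\<phi>\<close> to
  the free module kills the relators by the two multilinearity hypotheses; its kernel is a
  submodule, hence contains the null space they generate, and the extension factors through the
  quotient.\<close>

lemma tensor_power_lift:
  assumes W: "module K W"
    and \<phi>: "\<And>w. w \<in> words A k \<Longrightarrow> \<phi> w \<in> carrier W"
    and add: "\<And>u a b v. u @ a # v \<in> words A k \<Longrightarrow> u @ b # v \<in> words A k \<Longrightarrow>
        \<phi> (u @ (a \<oplus>\<^bsub>A\<^esub> b) # v) = \<phi> (u @ a # v) \<oplus>\<^bsub>W\<^esub> \<phi> (u @ b # v)"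
    and smult: "\<And>u a c v. u @ a # v \<in> words A k \<Longrightarrow> c \<in> carrier K \<Longrightarrow>
        \<phi> (u @ (c \<odot>\<^bsub>A\<^esub> a) # v) = c \<odot>\<^bsub>W\<^esub> \<phi> (u @ a # v)"
  obtains g where "g \<in> linear_maps K (TP k) W"
    and "\<And>w. w \<in> words A k \<Longrightarrow> g (pure_tensor K A w) = \<phi> w"
proof -
  interpret W: module K W by fact
  interpret F: module K "F k" by (rule F_module)
  obtain g where g: "g \<in> linear_maps K (F k) W" "\<And>w. w \<in> words A k \<Longrightarrow> g (free_basis K w) = \<phi> w"
    using free_lift[OF A.R.is_cring W, of "words A k" \<phi>] \<phi> by blast
  let ?ker = "{x \<in> carrier (F k). g x \<in> {\<zero>\<^bsub>W\<^esub>}}"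
  have "multilinear_rels K A k \<subseteq> ?ker"
  proof
    fix r assume r: "r \<in> multilinear_rels K A k"
    then have "g r = \<zero>\<^bsub>W\<^esub>"
    proof (cases rule: multilinear_rels_cases)
      case (add u a b v)
      then show ?thesis
        by (simp add: linear_maps_minus[OF F_module W g(1)] linear_maps_add[OF g(1)] g(2)
            F_basis_closed assms(3) \<phi> W.M.minus_eq_zero_iff)
    next
      case (smult u a c v)
      then show ?thesis
        by (simp add: linear_maps_minus[OF F_module W g(1)] linear_maps_smult[OF g(1)] g(2)
            F_basis_closed assms(4) \<phi> W.M.minus_eq_zero_iff)
    qed
    then show "r \<in> ?ker" using r multilinear_rels_closed by auto
  qed
  then have "N k \<subseteq> ?ker"
    unfolding tensor_null_def
    by (intro gen_submodule_least submodule_vimage[OF F_module W g(1)] W.zero_submodule)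
  then obtain h where h: "h \<in> linear_maps K (TP k) W" "\<And>x. x \<in> carrier (F k) \<Longrightarrow> h (cls k x) = g x"
    using quotient.quot_lift[OF N_quotient W g(1)] unfolding tensor_power_def by blast
  have "h (pure_tensor K A w) = \<phi> w" if "w \<in> words A k" for w
    using that by (simp add: pure_tensor_eq h(2) F_basis_closed g(2))
  with h(1) that show ?thesis by blast
qed

section \<open>Concatenation of tensors, on representatives and on cosets\<close>

lemma conv_closed:
  assumes f: "f \<in> carrier (F i)" and g: "g \<in> carrier (F j)"
  shows "conv i f g \<in> carrier (F (i + j))"
proof -
  have iff: "\<And>f k. f \<in> carrier (F k) \<longleftrightarrow> (\<forall>s. f s \<in> carrier K) \<and> finite {s. f s \<noteq> \<zero>} \<and>
      {s. f s \<noteq> \<zero>} \<subseteq> words A k"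
    by (rule free_carrier_iff[OF A.R.is_cring])
  \<comment> \<open>A nonzero coefficient at \<open>w\<close> forces both pieces of
    \<open>w\<close>, cut after \<open>i\<close> letters, into the supports of \<open>f\<close> and
    \<open>g\<close>; so the support of the product lies among finitely many concatenations.\<close>
  let ?S = "(\<lambda>(u, v). u @ v) ` ({u. f u \<noteq> \<zero>} \<times> {v. g v \<noteq> \<zero>})"
  have "{w. conv i f g w \<noteq> \<zero>} \<subseteq> ?S"
  proof
    fix w assume w: "w \<in> {w. conv i f g w \<noteq> \<zero>}"
    have "f (take i w) \<in> carrier K" "g (drop i w) \<in> carrier K" using f g by (auto simp: iff)
    with w have "f (take i w) \<noteq> \<zero>" "g (drop i w) \<noteq> \<zero>" by (auto simp: conv_def)
    then have "(take i w, drop i w) \<in> {u. f u \<noteq> \<zero>} \<times> {v. g v \<noteq> \<zero>}" by simp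
    then have "(\<lambda>(u, v). u @ v) (take i w, drop i w) \<in> ?S" by (rule imageI)
    then show "w \<in> ?S" by simp
  qed
  moreover have "finite ?S" using f g by (auto simp: iff)
  moreover have "?S \<subseteq> words A (i + j)"
    using f g by (fastforce simp: iff words_iff subset_iff)
  ultimately show ?thesis unfolding iff using f g
    by (auto simp: iff conv_def intro: finite_subset)
qed

lemma conv_linear_left: "g \<in> carrier (F j) \<Longrightarrow> (\<lambda>f. conv i f g) \<in> linear_maps K (F i) (F (i + j))"
  by (rule linear_mapsI)
    (auto simp: conv_closed, auto simp: conv_def free_module_simps[OF A.R.is_cring]
      free_carrier_coeff[OF A.R.is_cring] A.R.l_distr A.R.m_assoc)

lemma conv_linear_right: "f \<in> carrier (F i) \<Longrightarrow> (\<lambda>g. conv i f g) \<in> linear_maps K (F j) (F (i + j))"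
  by (rule linear_mapsI)
    (auto simp: conv_closed, auto simp: conv_def free_module_simps[OF A.R.is_cring]
      free_carrier_coeff[OF A.R.is_cring] A.R.r_distr A.R.m_lcomm)

text \<open>The length condition makes the cut fall exactly between \<open>u\<close> and
  \<open>v\<close>, so a word equals \<open>u @ v\<close> precisely when its two pieces
  match.\<close>

lemma conv_basis:
  "length u = i \<Longrightarrow> conv i (free_basis K u) (free_basis K v) = free_basis K (u @ v)"
  by (auto simp: conv_def free_basis_def fun_eq_iff) (metis append_take_drop_id)

text \<open>Appending a fixed word \<open>v\<close> to every word of a relator lengthens the tail
  behind the varied letter and yields a relator again, so the null space is carried into the null
  space. A general right factor is reached by linearity, with \<open>h\<close> kept arbitrary in the
  induction.\<close>

lemma conv_null_left:
  assumes h: "h \<in> N i" and g: "g \<in> carrier (F j)"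
  shows "conv i h g \<in> N (i + j)"
  using g h
proof (induction arbitrary: h rule: F_induct)
  case zero
  then have "h \<in> carrier (F i)" using module.submoduleE(1)[OF F_module N_submodule] by blast
  then show ?case
    using linear_maps_zero[OF F_module F_module conv_linear_right]
      module.submodule_zero[OF F_module N_submodule] by simp
next
  case (basis v)
  have e: "free_basis K v \<in> carrier (F j)" by (rule F_basis_closed[OF basis(1)])
  let ?L = "\<lambda>f. conv i f (free_basis K v)"
  have L: "?L \<in> linear_maps K (F i) (F (i + j))" by (rule conv_linear_left[OF e])
  have "multilinear_rels K A i \<subseteq> {x \<in> carrier (F i). ?L x \<in> N (i + j)}"
  proof
    fix r assume r: "r \<in> multilinear_rels K A i"
    interpret Fi: module K "F i" by (rule F_module)
    from r have "?L r \<in> multilinear_rels K A (i + j)"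
    proof (cases rule: multilinear_rels_cases)
      case (add u a b v')
      have "u @ a # (v' @ v) \<in> words A (i + j)" "b \<in> carrier A"
        using add basis(1) by (auto simp: words_iff)
      from multilinear_rels_add[OF this] show ?thesis
        using add by (simp add: linear_maps_minus[OF F_module F_module L] linear_maps_add[OF L]
            F_basis_closed conv_basis words_iff)
    next
      case (smult u a c v')
      have "u @ a # (v' @ v) \<in> words A (i + j)"
        using smult basis(1) by (auto simp: words_iff)
      from multilinear_rels_smult[OF this smult(3)] show ?thesis
        using smult by (simp add: linear_maps_minus[OF F_module F_module L] linear_maps_smult[OF L]
            F_basis_closed conv_basis words_iff)
    qed
    then show "r \<in> {x \<in> carrier (F i). ?L x \<in> N (i + j)}"
      using N_rels multilinear_rels_closed r by auto
  qed
  from gen_submodule_least[OF submodule_vimage[OF F_module F_module L N_submodule] this]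
  show ?case using basis(2) unfolding tensor_null_def[of K A i] by blast
next
  case (add f g)
  then have "h \<in> carrier (F i)" using module.submoduleE(1)[OF F_module N_submodule] by blast
  then show ?case
    using add by (simp add: linear_maps_add[OF conv_linear_right]
        module.submoduleE(5)[OF F_module N_submodule])
next
  case (smult c f)
  then have "h \<in> carrier (F i)" using module.submoduleE(1)[OF F_module N_submodule] by blast
  then show ?case
    using smult by (simp add: linear_maps_smult[OF conv_linear_right]
        module.submoduleE(4)[OF F_module N_submodule])
qed

text \<open>Mirror image: prepending a fixed word \<open>w\<close> lengthens the part of the relator
  in front of the varied letter.\<close>

lemma conv_null_right:
  assumes h: "h \<in> N j" and f: "f \<in> carrier (F i)"
  shows "conv i f h \<in> N (i + j)"
  using f h
proof (induction arbitrary: h rule: F_induct)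
  case zero
  then have "h \<in> carrier (F j)" using module.submoduleE(1)[OF F_module N_submodule] by blast
  then show ?case
    using linear_maps_zero[OF F_module F_module conv_linear_left]
      module.submodule_zero[OF F_module N_submodule] by simp
next
  case (basis w)
  have e: "free_basis K w \<in> carrier (F i)" by (rule F_basis_closed[OF basis(1)])
  let ?L = "\<lambda>g. conv i (free_basis K w) g"
  have L: "?L \<in> linear_maps K (F j) (F (i + j))" by (rule conv_linear_right[OF e])
  have len: "length w = i" using basis(1) by (simp add: words_iff)
  have "multilinear_rels K A j \<subseteq> {x \<in> carrier (F j). ?L x \<in> N (i + j)}"
  proof
    fix r assume r: "r \<in> multilinear_rels K A j"
    interpret Fj: module K "F j" by (rule F_module)
    from r have "?L r \<in> multilinear_rels K A (i + j)"
    proof (cases rule: multilinear_rels_cases)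
      case (add u a b v)
      have "(w @ u) @ a # v \<in> words A (i + j)" "b \<in> carrier A"
        using add basis(1) by (auto simp: words_iff)
      from multilinear_rels_add[OF this] show ?thesis
        using add by (simp add: linear_maps_minus[OF F_module F_module L] linear_maps_add[OF L]
            F_basis_closed conv_basis len)
    next
      case (smult u a c v)
      have "(w @ u) @ a # v \<in> words A (i + j)"
        using smult basis(1) by (auto simp: words_iff)
      from multilinear_rels_smult[OF this smult(3)] show ?thesis
        using smult by (simp add: linear_maps_minus[OF F_module F_module L] linear_maps_smult[OF L]
            F_basis_closed conv_basis len)
    qed
    then show "r \<in> {x \<in> carrier (F j). ?L x \<in> N (i + j)}"
      using N_rels multilinear_rels_closed r by auto
  qed
  from gen_submodule_least[OF submodule_vimage[OF F_module F_module L N_submodule] this]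
  show ?case using basis(2) unfolding tensor_null_def[of K A j] by blast
next
  case (add f g)
  then have "h \<in> carrier (F j)" using module.submoduleE(1)[OF F_module N_submodule] by blast
  then show ?case
    using add by (simp add: linear_maps_add[OF conv_linear_left]
        module.submoduleE(5)[OF F_module N_submodule])
next
  case (smult c f)
  then have "h \<in> carrier (F j)" using module.submoduleE(1)[OF F_module N_submodule] by blast
  then show ?case
    using smult by (simp add: linear_maps_smult[OF conv_linear_left]
        module.submoduleE(4)[OF F_module N_submodule])
qed

text \<open>Representatives are changed one factor at a time; each change alters the product by a
  concatenation with a null element, which is null.\<close>

lemma tensor_concat_cls:
  assumes f: "f \<in> carrier (F i)" and g: "g \<in> carrier (F j)"
  shows "tensor_concat K A i j (cls i f) (cls j g) = cls (i + j) (conv i f g)"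
proof -
  have *: "cls (i + j) (conv i f' g') = cls (i + j) (conv i f g)"
    if f': "f' \<in> cls i f" and g': "g' \<in> cls j g" for f' g'
  proof -
    note f'' = f'[unfolded quotient.coset_iff[OF N_quotient f]]
      and g'' = g'[unfolded quotient.coset_iff[OF N_quotient g]]
    have "cls (i + j) (conv i f' g') = cls (i + j) (conv i f g')"
      using f'' g'' f conv_null_left[of "f' \<ominus>\<^bsub>F i\<^esub> f" i g' j]
      by (intro quotient.coset_cong[OF N_quotient])
        (auto simp: conv_closed linear_maps_minus[OF F_module F_module conv_linear_left])
    also have "\<dots> = cls (i + j) (conv i f g)"
      using f'' g'' f g conv_null_right[of "g' \<ominus>\<^bsub>F j\<^esub> g" j f i]
      by (intro quotient.coset_cong[OF N_quotient])
        (auto simp: conv_closed linear_maps_minus[OF F_module F_module conv_linear_right])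
    finally show ?thesis .
  qed
  \<comment> \<open>Nonemptiness matters because \<open>tensor_concat\<close> is a union over
    representatives, and a constant union equals its value only over a nonempty index set.\<close>
  have "cls i f \<noteq> {}" "cls j g \<noteq> {}"
    using quotient.coset_iff[OF N_quotient] f g module.submodule_zero[OF F_module N_submodule]
      abelian_group.minus_eq_zero_iff[OF module.axioms(2)[OF F_module]] by (metis empty_iff)+
  then show ?thesis
    unfolding tensor_concat_def conv_def[symmetric] using * by auto
qed

lemma tensor_concat_closed:
  "X \<in> carrier (TP i) \<Longrightarrow> Y \<in> carrier (TP j) \<Longrightarrow> tensor_concat K A i j X Y \<in> carrier (TP (i + j))"
  by (auto simp: TP_carrier tensor_concat_cls conv_closed)

lemma tensor_concat_linear_left:
  assumes Y: "Y \<in> carrier (TP j)"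
  shows "(\<lambda>X. tensor_concat K A i j X Y) \<in> linear_maps K (TP i) (TP (i + j))"
proof -
  obtain g where g: "g \<in> carrier (F j)" "Y = cls j g" using Y by (auto simp: TP_carrier)
  interpret Fi: module K "F i" by (rule F_module)
  show ?thesis
    by (rule linear_mapsI)
      (use g in \<open>auto simp: TP_carrier TP_add TP_smult tensor_concat_cls conv_closed
        linear_maps_add[OF conv_linear_left] linear_maps_smult[OF conv_linear_left]\<close>)
qed

lemma tensor_concat_linear_right:
  assumes X: "X \<in> carrier (TP i)"
  shows "(\<lambda>Y. tensor_concat K A i j X Y) \<in> linear_maps K (TP j) (TP (i + j))"
proof -
  obtain f where f: "f \<in> carrier (F i)" "X = cls i f" using X by (auto simp: TP_carrier)
  interpret Fj: module K "F j" by (rule F_module)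
  show ?thesis
    by (rule linear_mapsI)
      (use f in \<open>auto simp: TP_carrier TP_add TP_smult tensor_concat_cls conv_closed
        linear_maps_add[OF conv_linear_right] linear_maps_smult[OF conv_linear_right]\<close>)
qed

lemma tensor_concat_pure:
  "u \<in> words A i \<Longrightarrow> v \<in> words A j \<Longrightarrow>
    tensor_concat K A i j (pure_tensor K A u) (pure_tensor K A v) = pure_tensor K A (u @ v)"
  using pure_tensor_eq[of "u @ v" "i + j"]
  by (simp add: pure_tensor_eq[of u i] pure_tensor_eq[of v j] tensor_concat_cls F_basis_closed
      conv_basis words_iff)

end


section \<open>Algebra ideals\<close>

text \<open>Distributivity, scalar compatibility and closure in the form of linear maps, so that the
  facts on zero, differences and preimages apply directly to multiplication by a fixed
  element.\<close>

definition bilinear_mult :: "('k, 'x) ring_scheme \<Rightarrow> ('k, 'a, 'y) module_scheme \<Rightarrow> bool"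
  where "bilinear_mult K V \<longleftrightarrow> (\<forall>y\<in>carrier V. (\<lambda>x. x \<otimes>\<^bsub>V\<^esub> y) \<in> linear_maps K V V \<and>
    (\<lambda>x. y \<otimes>\<^bsub>V\<^esub> x) \<in> linear_maps K V V)"

lemma bilinear_mult_left: "bilinear_mult K V \<Longrightarrow> y \<in> carrier V \<Longrightarrow> (\<lambda>x. x \<otimes>\<^bsub>V\<^esub> y) \<in> linear_maps K V V"
  and bilinear_mult_right: "bilinear_mult K V \<Longrightarrow> y \<in> carrier V \<Longrightarrow> (\<lambda>x. y \<otimes>\<^bsub>V\<^esub> x) \<in> linear_maps K V V"
  by (auto simp: bilinear_mult_def)

lemma bilinear_mult_closed:
  "bilinear_mult K V \<Longrightarrow> x \<in> carrier V \<Longrightarrow> y \<in> carrier V \<Longrightarrow> x \<otimes>\<^bsub>V\<^esub> y \<in> carrier V"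
  using linear_maps_closed[OF bilinear_mult_left] .

lemma (in assoc_algebra) bilinear_mult: "bilinear_mult K M"
  unfolding bilinear_mult_def
  by (auto intro!: linear_mapsI alg_mult_closed alg_l_distr alg_r_distr alg_smult_l alg_smult_r)

lemma gen_alg_ideal_is_ideal:
  assumes V: "module K V" and m: "bilinear_mult K V" and S: "S \<subseteq> carrier V"
  shows "alg_ideal K V (gen_alg_ideal K V S)"
proof -
  interpret V: module K V by fact
  \<comment> \<open>The whole space is an ideal containing \<open>S\<close>, so the intersection
    defining the generated ideal runs over a nonempty family.\<close>
  have "alg_ideal K V (carrier V)"
    using V.carrier_is_submodule m by (auto simp: alg_ideal_def bilinear_mult_closed)
  then have "submodule (gen_alg_ideal K V S) K V"
    unfolding gen_alg_ideal_def using S by (intro V.submodule_Inter) (auto simp: alg_ideal_def)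
  then show ?thesis
    unfolding alg_ideal_def gen_alg_ideal_def by (auto simp: alg_ideal_def)
qed

lemma gen_alg_ideal_least: "alg_ideal K V I \<Longrightarrow> S \<subseteq> I \<Longrightarrow> gen_alg_ideal K V S \<subseteq> I"
  by (auto simp: gen_alg_ideal_def)

text \<open>Factors are replaced one at a time: \<open>x'y' - xy' = (x' - x)y'\<close> and
  \<open>xy' - xy = x(y' - y)\<close> lie in the ideal by absorption on either side.\<close>

lemma quot_mult:
  assumes V: "module K V" and m: "bilinear_mult K V" and H: "alg_ideal K V H"
    and x: "x \<in> carrier V" and y: "y \<in> carrier V"
  shows "(H +>\<^bsub>V\<^esub> x) \<otimes>\<^bsub>quot_module V H\<^esub> (H +>\<^bsub>V\<^esub> y) = H +>\<^bsub>V\<^esub> (x \<otimes>\<^bsub>V\<^esub> y)"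
proof -
  interpret quotient K V H
    using V H by (intro quotientI) (auto simp: alg_ideal_def)
  have ideal: "h \<otimes>\<^bsub>V\<^esub> z \<in> H" "z \<otimes>\<^bsub>V\<^esub> h \<in> H" if "h \<in> H" "z \<in> carrier V" for h z
    using H that by (auto simp: alg_ideal_def)
  have "H +>\<^bsub>V\<^esub> (x' \<otimes>\<^bsub>V\<^esub> y') = H +>\<^bsub>V\<^esub> (x \<otimes>\<^bsub>V\<^esub> y)"
    if x': "x' \<in> H +>\<^bsub>V\<^esub> x" and y': "y' \<in> H +>\<^bsub>V\<^esub> y" for x' y'
  proof -
    note x'' = x'[unfolded coset_iff[OF x]] and y'' = y'[unfolded coset_iff[OF y]]
    have "H +>\<^bsub>V\<^esub> (x' \<otimes>\<^bsub>V\<^esub> y') = H +>\<^bsub>V\<^esub> (x \<otimes>\<^bsub>V\<^esub> y')"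
      using x'' y'' x ideal(1)[of "x' \<ominus>\<^bsub>V\<^esub> x" y'] m
        linear_maps_minus[OF V V bilinear_mult_left[OF m, of y'], of x' x]
      by (intro coset_cong) (auto simp: bilinear_mult_closed)
    also have "\<dots> = H +>\<^bsub>V\<^esub> (x \<otimes>\<^bsub>V\<^esub> y)"
      using y'' x y ideal(2)[of "y' \<ominus>\<^bsub>V\<^esub> y" x] m
        linear_maps_minus[OF V V bilinear_mult_right[OF m, of x], of y' y]
      by (intro coset_cong) (auto simp: bilinear_mult_closed)
    finally show ?thesis .
  qed
  then have "(\<Union>a\<in>H +>\<^bsub>V\<^esub> x. \<Union>b\<in>H +>\<^bsub>V\<^esub> y. H +>\<^bsub>V\<^esub> (a \<otimes>\<^bsub>V\<^esub> b)) = H +>\<^bsub>V\<^esub> (x \<otimes>\<^bsub>V\<^esub> y)"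
    using sub.a_rcos_self[OF x] sub.a_rcos_self[OF y] by blast
  then show ?thesis by (simp add: quot_module_def FactRing_def rcoset_mult_def)
qed


text \<open>Absorption holds because zero annihilates every element of \<open>W\<close>, which is
  linearity of multiplication in each factor evaluated at zero. Serves to bound the enveloping ideal
  by its generators.\<close>

lemma alg_ideal_kernel:
  assumes V: "module K V" and m: "bilinear_mult K V" and W: "assoc_algebra K W"
    and f: "f \<in> linear_maps K V W"
    and mult: "\<And>x y. x \<in> carrier V \<Longrightarrow> y \<in> carrier V \<Longrightarrow> f (x \<otimes>\<^bsub>V\<^esub> y) = f x \<otimes>\<^bsub>W\<^esub> f y"
  shows "alg_ideal K V {x \<in> carrier V. f x \<in> {\<zero>\<^bsub>W\<^esub>}}"
proof -
  interpret W: assoc_algebra K W by fact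
  have "\<zero>\<^bsub>W\<^esub> \<otimes>\<^bsub>W\<^esub> y = \<zero>\<^bsub>W\<^esub>" "y \<otimes>\<^bsub>W\<^esub> \<zero>\<^bsub>W\<^esub> = \<zero>\<^bsub>W\<^esub>" if "y \<in> carrier W" for y
    using linear_maps_zero[OF W.module_axioms W.module_axioms bilinear_mult_left[OF W.bilinear_mult that]]
      linear_maps_zero[OF W.module_axioms W.module_axioms bilinear_mult_right[OF W.bilinear_mult that]]
    by auto
  then show ?thesis
    unfolding alg_ideal_def
    using submodule_vimage[OF V W.module_axioms f W.zero_submodule] bilinear_mult_closed[OF m]
    by (auto simp: mult linear_maps_closed[OF f])
qed


section \<open>The tensor algebra\<close>

context tensors
begin

abbreviation T where "T \<equiv> tensor_algebra K A"
abbreviation supp where "supp x \<equiv> {k \<in> {1..}. x k \<noteq> \<zero>\<^bsub>TP k\<^esub>}"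

lemma T_carrier_iff: "x \<in> carrier T \<longleftrightarrow>
    x \<in> extensional {1..} \<and> (\<forall>k\<ge>1. x k \<in> carrier (TP k)) \<and> finite (supp x)"
  by (auto simp: tensor_algebra_def PiE_iff)

lemma T_coeff: "x \<in> carrier T \<Longrightarrow> k \<ge> 1 \<Longrightarrow> x k \<in> carrier (TP k)"
  by (simp add: T_carrier_iff)

lemma T_apply:
  "k \<ge> 1 \<Longrightarrow> (x \<oplus>\<^bsub>T\<^esub> y) k = x k \<oplus>\<^bsub>TP k\<^esub> y k" "k \<ge> 1 \<Longrightarrow> (c \<odot>\<^bsub>T\<^esub> x) k = c \<odot>\<^bsub>TP k\<^esub> x k"
  "k \<ge> 1 \<Longrightarrow> \<zero>\<^bsub>T\<^esub> k = \<zero>\<^bsub>TP k\<^esub>"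
  "k \<ge> 1 \<Longrightarrow> (x \<otimes>\<^bsub>T\<^esub> y) k =
    (\<Oplus>\<^bsub>TP k\<^esub>i\<in>{1..<k}. tensor_concat K A i (k - i) (x i) (y (k - i)))"
  by (simp_all add: tensor_algebra_def)

lemma T_extensional_1:
  "x \<oplus>\<^bsub>T\<^esub> y \<in> extensional {1..}" "c \<odot>\<^bsub>T\<^esub> x \<in> extensional {1..}" "\<zero>\<^bsub>T\<^esub> \<in> extensional {1..}"
  "x \<otimes>\<^bsub>T\<^esub> y \<in> extensional {1..}" "x \<in> carrier T \<Longrightarrow> x \<in> extensional {1..}"
  by (auto simp: tensor_algebra_def PiE_def)

lemmas T_extensional = T_extensional_1 T_extensional_1[unfolded One_nat_def]

lemma T_eqI:
  assumes "x \<in> extensional {1..}" "y \<in> extensional {1..}" "\<And>k. k \<ge> 1 \<Longrightarrow> x k = y k"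
  shows "x = y"
  using assms by (intro extensionalityI[of x "{1..}" y]) auto

lemma TP_abelian_group: "abelian_group (TP k)"
  by (rule module.axioms(2)[OF TP_module])

lemma T_add_closed: "x \<in> carrier T \<Longrightarrow> y \<in> carrier T \<Longrightarrow> x \<oplus>\<^bsub>T\<^esub> y \<in> carrier T"
proof -
  assume x: "x \<in> carrier T" and y: "y \<in> carrier T"
  have "supp (x \<oplus>\<^bsub>T\<^esub> y) \<subseteq> supp x \<union> supp y"
    using abelian_monoid.l_zero[OF abelian_group.axioms(1)[OF TP_abelian_group]]
      abelian_monoid.zero_closed[OF abelian_group.axioms(1)[OF TP_abelian_group]]
    by (auto simp: T_apply)
  then show ?thesis using x y abelian_groupE(1)[OF TP_abelian_group]
    unfolding T_carrier_iff by (auto intro: finite_subset simp: T_apply T_extensional)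
qed

lemma T_smult_closed: "c \<in> carrier K \<Longrightarrow> x \<in> carrier T \<Longrightarrow> c \<odot>\<^bsub>T\<^esub> x \<in> carrier T"
proof -
  assume c: "c \<in> carrier K" and x: "x \<in> carrier T"
  have "supp (c \<odot>\<^bsub>T\<^esub> x) \<subseteq> supp x"
    using module.smult_r_null[OF TP_module c] by (auto simp: T_apply)
  then show ?thesis using c x module.smult_closed[OF TP_module]
    unfolding T_carrier_iff by (auto intro: finite_subset simp: T_apply T_extensional)
qed

lemma T_zero_closed: "\<zero>\<^bsub>T\<^esub> \<in> carrier T"
proof -
  have "supp \<zero>\<^bsub>T\<^esub> = {}" by (auto simp: T_apply)
  then have "finite (supp \<zero>\<^bsub>T\<^esub>)" by (simp only: finite.emptyI)
  then show ?thesis unfolding T_carrier_iff using abelian_groupE(2)[OF TP_abelian_group]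
    by (simp add: T_apply T_extensional)
qed

lemma T_module: "module K T"
proof (rule moduleI[OF A.R.is_cring])
  show "abelian_group T"
  proof (rule abelian_groupI)
    fix x assume x: "x \<in> carrier T"
    \<comment> \<open>The additive inverse is exhibited as the multiple by minus one, whose finite
      support is already known from closure under scalars.\<close>
    have c: "\<ominus> \<one> \<in> carrier K" by simp
    have "(\<ominus> \<one>) \<odot>\<^bsub>T\<^esub> x \<oplus>\<^bsub>T\<^esub> x = \<zero>\<^bsub>T\<^esub>"
    proof (rule T_eqI)
      fix k :: nat assume k: "k \<ge> 1"
      interpret TPk: module K "TP k" by (rule TP_module)
      show "((\<ominus> \<one>) \<odot>\<^bsub>T\<^esub> x \<oplus>\<^bsub>T\<^esub> x) k = \<zero>\<^bsub>T\<^esub> k"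
        using T_coeff[OF x k] k by (simp add: T_apply TPk.minus_eq_smult[symmetric] TPk.M.l_neg)
    qed (auto simp: T_extensional)
    then show "\<exists>y\<in>carrier T. y \<oplus>\<^bsub>T\<^esub> x = \<zero>\<^bsub>T\<^esub>" using T_smult_closed[OF c x] by blast
  next
    fix x y z assume xyz: "x \<in> carrier T" "y \<in> carrier T" "z \<in> carrier T"
    show "x \<oplus>\<^bsub>T\<^esub> y \<oplus>\<^bsub>T\<^esub> z = x \<oplus>\<^bsub>T\<^esub> (y \<oplus>\<^bsub>T\<^esub> z)"
      by (rule T_eqI) (use xyz abelian_groupE(3)[OF TP_abelian_group] in
          \<open>auto simp: T_apply T_extensional T_coeff\<close>)
  next
    fix x y assume xyz: "x \<in> carrier T" "y \<in> carrier T"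
    show "x \<oplus>\<^bsub>T\<^esub> y = y \<oplus>\<^bsub>T\<^esub> x"
      by (rule T_eqI) (use xyz abelian_groupE(4)[OF TP_abelian_group] in
          \<open>auto simp: T_apply T_extensional T_coeff\<close>)
  next
    fix x assume xyz: "x \<in> carrier T"
    show "\<zero>\<^bsub>T\<^esub> \<oplus>\<^bsub>T\<^esub> x = x"
      by (rule T_eqI) (use xyz abelian_groupE(5)[OF TP_abelian_group] in
          \<open>auto simp: T_apply T_extensional T_coeff\<close>)
  qed (auto simp: T_add_closed T_zero_closed)
next
  fix a b x y assume ab: "a \<in> carrier K" "b \<in> carrier K" and xy: "x \<in> carrier T" "y \<in> carrier T"
  show "(a \<oplus> b) \<odot>\<^bsub>T\<^esub> x = a \<odot>\<^bsub>T\<^esub> x \<oplus>\<^bsub>T\<^esub> b \<odot>\<^bsub>T\<^esub> x"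
    by (rule T_eqI) (use ab xy module.smult_l_distr[OF TP_module] in
          \<open>auto simp: T_apply T_extensional T_coeff\<close>)
  show "a \<odot>\<^bsub>T\<^esub> (x \<oplus>\<^bsub>T\<^esub> y) = a \<odot>\<^bsub>T\<^esub> x \<oplus>\<^bsub>T\<^esub> a \<odot>\<^bsub>T\<^esub> y"
    by (rule T_eqI) (use ab xy module.smult_r_distr[OF TP_module] in
          \<open>auto simp: T_apply T_extensional T_coeff\<close>)
  show "(a \<otimes> b) \<odot>\<^bsub>T\<^esub> x = a \<odot>\<^bsub>T\<^esub> (b \<odot>\<^bsub>T\<^esub> x)"
    by (rule T_eqI) (use ab xy module.smult_assoc1[OF TP_module] in
          \<open>auto simp: T_apply T_extensional T_coeff\<close>)
next
  fix x assume x: "x \<in> carrier T"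
  show "\<one> \<odot>\<^bsub>T\<^esub> x = x"
    by (rule T_eqI) (use x module.smult_one[OF TP_module] in
          \<open>auto simp: T_apply T_extensional T_coeff\<close>)
qed (simp add: T_smult_closed)

section \<open>Closure and bilinearity of the product of T(A)\<close>

lemma concat_left: "i \<le> k \<Longrightarrow> Y \<in> carrier (TP (k - i)) \<Longrightarrow>
    (\<lambda>X. tensor_concat K A i (k - i) X Y) \<in> linear_maps K (TP i) (TP k)"
  using tensor_concat_linear_left[of Y "k - i" i] by simp

lemma concat_right: "i \<le> k \<Longrightarrow> X \<in> carrier (TP i) \<Longrightarrow>
    (\<lambda>Y. tensor_concat K A i (k - i) X Y) \<in> linear_maps K (TP (k - i)) (TP k)"
  using tensor_concat_linear_right[of X i "k - i"] by simp

lemma concat_zero: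
  assumes "i \<le> k"
  shows "Y \<in> carrier (TP (k - i)) \<Longrightarrow> tensor_concat K A i (k - i) \<zero>\<^bsub>TP i\<^esub> Y = \<zero>\<^bsub>TP k\<^esub>"
    and "X \<in> carrier (TP i) \<Longrightarrow> tensor_concat K A i (k - i) X \<zero>\<^bsub>TP (k - i)\<^esub> = \<zero>\<^bsub>TP k\<^esub>"
  using linear_maps_zero[OF TP_module TP_module concat_left[OF assms]]
    linear_maps_zero[OF TP_module TP_module concat_right[OF assms]] by blast+

lemma concat_coeff_closed:
  assumes "x \<in> carrier T" "y \<in> carrier T" "i \<in> {1..<k}"
  shows "tensor_concat K A i (k - i) (x i) (y (k - i)) \<in> carrier (TP k)"
proof -
  have "i \<ge> 1" "k - i \<ge> 1" "i + (k - i) = k" using assms(3) by auto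
  then show ?thesis
    using tensor_concat_closed[OF T_coeff[OF assms(1)] T_coeff[OF assms(2)], of i "k - i"] by simp
qed

lemma T_mult_closed:
  assumes x: "x \<in> carrier T" and y: "y \<in> carrier T"
  shows "x \<otimes>\<^bsub>T\<^esub> y \<in> carrier T"
proof -
  \<comment> \<open>A nonzero component in degree \<open>k\<close> needs a nonzero summand, and
    concatenation with a zero tensor vanishes; so \<open>k\<close> is a sum of a degree from each
    support.\<close>
  let ?S = "(\<lambda>(i, j). i + j) ` (supp x \<times> supp y)"
  have "supp (x \<otimes>\<^bsub>T\<^esub> y) \<subseteq> ?S"
  proof
    fix k assume k: "k \<in> supp (x \<otimes>\<^bsub>T\<^esub> y)"
    interpret TPk: module K "TP k" by (rule TP_module)
    have "\<exists>i\<in>{1..<k}. tensor_concat K A i (k - i) (x i) (y (k - i)) \<noteq> \<zero>\<^bsub>TP k\<^esub>"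
      using k TPk.add.finprod_one_eqI[of "{1..<k}"] by (auto simp: T_apply)
    then obtain i where i: "i \<in> {1..<k}" "tensor_concat K A i (k - i) (x i) (y (k - i)) \<noteq> \<zero>\<^bsub>TP k\<^esub>"
      by blast
    have "x i \<noteq> \<zero>\<^bsub>TP i\<^esub>"
      using i concat_zero(1)[of i k "y (k - i)"]
        T_coeff[OF y, of "k - i"] by auto
    moreover have "y (k - i) \<noteq> \<zero>\<^bsub>TP (k - i)\<^esub>"
      using i concat_zero(2)[of i k "x i"]
        T_coeff[OF x, of i] by auto
    ultimately have "(i, k - i) \<in> supp x \<times> supp y" using i by auto
    then have "(\<lambda>(i, j). i + j) (i, k - i) \<in> ?S" by (rule imageI)
    then show "k \<in> ?S" using i by simp
  qed
  moreover have "finite ?S" using x y by (auto simp: T_carrier_iff)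
  moreover have "(x \<otimes>\<^bsub>T\<^esub> y) k \<in> carrier (TP k)" if "k \<ge> 1" for k
  proof -
    interpret TPk: module K "TP k" by (rule TP_module)
    show ?thesis using that concat_coeff_closed[OF x y]
      by (simp only: T_apply) (intro TPk.M.finsum_closed Pi_I)
  qed
  ultimately show ?thesis
    unfolding T_carrier_iff by (auto intro: finite_subset simp: T_extensional)
qed

text \<open>Holds degree by degree: a component of the product is a finite sum of concatenations,
  each linear in its left factor.\<close>

lemma T_mult_linear_left:
  assumes y: "y \<in> carrier T"
  shows "(\<lambda>x. x \<otimes>\<^bsub>T\<^esub> y) \<in> linear_maps K T T"
proof (rule linear_mapsI)
  fix x x' assume x: "x \<in> carrier T" "x' \<in> carrier T"
  show "(x \<oplus>\<^bsub>T\<^esub> x') \<otimes>\<^bsub>T\<^esub> y = x \<otimes>\<^bsub>T\<^esub> y \<oplus>\<^bsub>T\<^esub> x' \<otimes>\<^bsub>T\<^esub> y"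
  proof (rule T_eqI)
    fix k :: nat assume k: "k \<ge> 1"
    interpret TPk: module K "TP k" by (rule TP_module)
    show "((x \<oplus>\<^bsub>T\<^esub> x') \<otimes>\<^bsub>T\<^esub> y) k = (x \<otimes>\<^bsub>T\<^esub> y \<oplus>\<^bsub>T\<^esub> x' \<otimes>\<^bsub>T\<^esub> y) k"
      using k x y
      by (simp add: T_apply concat_coeff_closed Pi_def flip: TPk.M.finsum_addf)
        (rule TPk.M.finsum_cong', auto simp: concat_coeff_closed T_apply linear_maps_add[OF concat_left] T_coeff)
  qed (auto simp: T_extensional)
next
  fix c x assume c: "c \<in> carrier K" and x: "x \<in> carrier T"
  show "(c \<odot>\<^bsub>T\<^esub> x) \<otimes>\<^bsub>T\<^esub> y = c \<odot>\<^bsub>T\<^esub> (x \<otimes>\<^bsub>T\<^esub> y)"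
  proof (rule T_eqI)
    fix k :: nat assume k: "k \<ge> 1"
    interpret TPk: module K "TP k" by (rule TP_module)
    show "((c \<odot>\<^bsub>T\<^esub> x) \<otimes>\<^bsub>T\<^esub> y) k = (c \<odot>\<^bsub>T\<^esub> (x \<otimes>\<^bsub>T\<^esub> y)) k"
      using k c x y
      by (simp add: T_apply concat_coeff_closed Pi_def TPk.finsum_smult_ldistr)
        (rule TPk.M.finsum_cong', auto simp: concat_coeff_closed T_apply linear_maps_smult[OF concat_left] T_coeff)
  qed (auto simp: T_extensional)
qed (rule T_mult_closed[OF _ y])

lemma T_mult_linear_right:
  assumes y: "y \<in> carrier T"
  shows "(\<lambda>x. y \<otimes>\<^bsub>T\<^esub> x) \<in> linear_maps K T T"
proof (rule linear_mapsI)
  fix x x' assume x: "x \<in> carrier T" "x' \<in> carrier T"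
  show "y \<otimes>\<^bsub>T\<^esub> (x \<oplus>\<^bsub>T\<^esub> x') = y \<otimes>\<^bsub>T\<^esub> x \<oplus>\<^bsub>T\<^esub> y \<otimes>\<^bsub>T\<^esub> x'"
  proof (rule T_eqI)
    fix k :: nat assume k: "k \<ge> 1"
    interpret TPk: module K "TP k" by (rule TP_module)
    show "(y \<otimes>\<^bsub>T\<^esub> (x \<oplus>\<^bsub>T\<^esub> x')) k = (y \<otimes>\<^bsub>T\<^esub> x \<oplus>\<^bsub>T\<^esub> y \<otimes>\<^bsub>T\<^esub> x') k"
      using k x y
      by (simp add: T_apply concat_coeff_closed Pi_def flip: TPk.M.finsum_addf)
        (rule TPk.M.finsum_cong', auto simp: concat_coeff_closed T_apply linear_maps_add[OF concat_right] T_coeff)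
  qed (auto simp: T_extensional)
next
  fix c x assume c: "c \<in> carrier K" and x: "x \<in> carrier T"
  show "y \<otimes>\<^bsub>T\<^esub> (c \<odot>\<^bsub>T\<^esub> x) = c \<odot>\<^bsub>T\<^esub> (y \<otimes>\<^bsub>T\<^esub> x)"
  proof (rule T_eqI)
    fix k :: nat assume k: "k \<ge> 1"
    interpret TPk: module K "TP k" by (rule TP_module)
    show "(y \<otimes>\<^bsub>T\<^esub> (c \<odot>\<^bsub>T\<^esub> x)) k = (c \<odot>\<^bsub>T\<^esub> (y \<otimes>\<^bsub>T\<^esub> x)) k"
      using k c x y
      by (simp add: T_apply concat_coeff_closed Pi_def TPk.finsum_smult_ldistr)
        (rule TPk.M.finsum_cong', auto simp: concat_coeff_closed T_apply linear_maps_smult[OF concat_right] T_coeff)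
  qed (auto simp: T_extensional)
qed (rule T_mult_closed[OF y])

lemma T_bilinear_mult: "bilinear_mult K T"
  by (simp add: bilinear_mult_def T_mult_linear_left T_mult_linear_right)

section \<open>Homogeneous elements, words, and maps out of T(A)\<close>

definition single where "single k X = (\<lambda>j\<in>{1..}. if j = k then X else \<zero>\<^bsub>TP j\<^esub>)"

lemma single_closed: "X \<in> carrier (TP k) \<Longrightarrow> single k X \<in> carrier T"
proof -
  have "supp (single k X) \<subseteq> {k}" by (auto simp: single_def)
  then show "X \<in> carrier (TP k) \<Longrightarrow> ?thesis"
    unfolding T_carrier_iff using abelian_groupE(2)[OF TP_abelian_group]
    by (auto intro: finite_subset simp: single_def)
qed

text \<open>No lower bound on \<open>k\<close> is imposed: for \<open>k = 0\<close> no index matches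
  and the map is identically zero.\<close>

lemma single_linear: "single k \<in> linear_maps K (TP k) T"
proof (rule linear_mapsI)
  fix X Y show "single k (X \<oplus>\<^bsub>TP k\<^esub> Y) = single k X \<oplus>\<^bsub>T\<^esub> single k Y"
    by (rule T_eqI) (use abelian_groupE(5,2)[OF TP_abelian_group] in
        \<open>auto simp: T_extensional T_apply, auto simp: single_def\<close>)
next
  fix c X assume "c \<in> carrier K"
  then show "single k (c \<odot>\<^bsub>TP k\<^esub> X) = c \<odot>\<^bsub>T\<^esub> single k X"
    by (intro T_eqI) (use module.smult_r_null[OF TP_module] in
        \<open>auto simp: T_extensional T_apply, auto simp: single_def\<close>)
qed (rule single_closed)

lemma tensor_inj_eq: "tensor_inj K A w = single (length w) (pure_tensor K A w)"
  by (auto simp: tensor_inj_def single_def)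

lemma tensor_inj_closed: "set w \<subseteq> carrier A \<Longrightarrow> tensor_inj K A w \<in> carrier T"
  using pure_tensor_closed[of w "length w"] by (simp add: tensor_inj_eq single_closed words_iff)

text \<open>In the sum over splittings of degree \<open>k\<close> only the one at
  \<open>length u\<close> can survive, and only in degree \<open>length u + length v\<close>.
  Nonemptiness of both words places that splitting inside \<open>{1..<k}\<close>.\<close>

lemma tensor_inj_mult:
  assumes u: "set u \<subseteq> carrier A" "u \<noteq> []" and v: "set v \<subseteq> carrier A" "v \<noteq> []"
  shows "tensor_inj K A u \<otimes>\<^bsub>T\<^esub> tensor_inj K A v = tensor_inj K A (u @ v)"
proof (rule T_eqI)
  fix k :: nat assume k: "k \<ge> 1"
  interpret TPk: module K "TP k" by (rule TP_module)
  have uv: "u \<in> words A (length u)" "v \<in> words A (length v)"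
    and P: "pure_tensor K A (u @ v) \<in> carrier (TP (length u + length v))"
    using u v pure_tensor_closed[of "u @ v"] by (auto simp: words_iff)
  \<comment> \<open>The summands as a function nonzero at no index other than
    \<open>length u\<close>, the shape in which a sum with a single surviving term can be
    evaluated.\<close>
  let ?c = "\<lambda>i. if length u = i then if k = length u + length v then pure_tensor K A (u @ v)
      else \<zero>\<^bsub>TP k\<^esub> else \<zero>\<^bsub>TP k\<^esub>"
  have c: "tensor_concat K A i (k - i) (tensor_inj K A u i) (tensor_inj K A v (k - i)) = ?c i"
    if i: "i \<in> {1..<k}" for i
  proof (cases "i = length u \<and> k - i = length v")
    case True
    then have eq: "i = length u" "k - i = length v" "k = length u + length v" using i by auto
    have "tensor_inj K A u (length u) = pure_tensor K A u" "tensor_inj K A v (length v) = pure_tensor K A v"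
      using u v by (simp_all add: tensor_inj_def Suc_le_eq)
    then show ?thesis unfolding eq(2) using tensor_concat_pure[OF uv] eq(1,3) by metis
  next
    case False
    then have "tensor_inj K A u i = \<zero>\<^bsub>TP i\<^esub> \<or> tensor_inj K A v (k - i) = \<zero>\<^bsub>TP (k - i)\<^esub>"
      using i by (auto simp: tensor_inj_def)
    moreover have "tensor_inj K A u i \<in> carrier (TP i)" "tensor_inj K A v (k - i) \<in> carrier (TP (k - i))"
      using i T_coeff[OF tensor_inj_closed] u v by auto
    moreover have "i \<le> k" using i by simp
    ultimately have "tensor_concat K A i (k - i) (tensor_inj K A u i) (tensor_inj K A v (k - i)) = \<zero>\<^bsub>TP k\<^esub>"
      by (metis concat_zero)
    moreover have "\<not> (length u = i \<and> k = length u + length v)" using False by linarith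
    ultimately show ?thesis by presburger
  qed
  have "(tensor_inj K A u \<otimes>\<^bsub>T\<^esub> tensor_inj K A v) k = (\<Oplus>\<^bsub>TP k\<^esub>i\<in>{1..<k}. ?c i)"
    unfolding T_apply(4)[OF k] by (rule TPk.M.finsum_cong'[OF refl _ c])
      (use P abelian_groupE(2)[OF TP_abelian_group] in auto)
  also have "\<dots> = tensor_inj K A (u @ v) k"
  proof (cases "k = length u + length v")
    case True
    then have "(\<Oplus>\<^bsub>TP k\<^esub>i\<in>{1..<k}. ?c i) = (if k = length u + length v then pure_tensor K A (u @ v)
      else \<zero>\<^bsub>TP k\<^esub>)"
      using u v P by (intro TPk.M.finsum_singleton) (auto simp: Suc_le_eq)
    then show ?thesis using True k by (simp add: tensor_inj_def)
  next
    case False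
    then have "(\<Oplus>\<^bsub>TP k\<^esub>i\<in>{1..<k}. ?c i) = \<zero>\<^bsub>TP k\<^esub>" by (intro TPk.add.finprod_one_eqI) auto
    then show ?thesis using False k by (simp add: tensor_inj_def)
  qed
  finally show "(tensor_inj K A u \<otimes>\<^bsub>T\<^esub> tensor_inj K A v) k = tensor_inj K A (u @ v) k" .
qed (auto simp: T_extensional, auto simp: tensor_inj_def)

text \<open>Words span, with control of degrees: if the components of \<open>x\<close> live in
  degrees from \<open>D\<close>, only words of such lengths have to be treated.
  \<open>D = UNIV\<close> gives plain induction; a residue class gives the statement about
  gradings.\<close>

lemma tensor_algebra_induct [consumes 2, case_names zero inj add smult]:
  assumes x: "x \<in> carrier T" and D: "supp x \<subseteq> D"
    and zero: "P \<zero>\<^bsub>T\<^esub>"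
    and inj: "\<And>w. w \<noteq> [] \<Longrightarrow> set w \<subseteq> carrier A \<Longrightarrow> length w \<in> D \<Longrightarrow> P (tensor_inj K A w)"
    and add: "\<And>x y. x \<in> carrier T \<Longrightarrow> y \<in> carrier T \<Longrightarrow> P x \<Longrightarrow> P y \<Longrightarrow> P (x \<oplus>\<^bsub>T\<^esub> y)"
    and smult: "\<And>c x. c \<in> carrier K \<Longrightarrow> x \<in> carrier T \<Longrightarrow> P x \<Longrightarrow> P (c \<odot>\<^bsub>T\<^esub> x)"
  shows "P x"
proof -
  have single: "P (single k X)" if X: "X \<in> carrier (TP k)" and k: "k \<ge> 1" "k \<in> D" for k X
    using X
  proof (induction rule: tensor_power_induct)
    case zero
    then show ?case using assms(3) linear_maps_zero[OF TP_module T_module single_linear] by simp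
  next
    case (pure w)
    then show ?case using inj[of w] k by (cases w) (auto simp: tensor_inj_eq words_iff)
  next
    case (add X Y)
    then show ?case using assms(5) by (simp add: linear_maps_add[OF single_linear] single_closed)
  next
    case (smult c X)
    then show ?case using assms(6) by (simp add: linear_maps_smult[OF single_linear] single_closed)
  qed
  have "P x" if "finite S" "x \<in> carrier T" "supp x \<subseteq> S" "S \<subseteq> D" for S x
    using that
  proof (induction S arbitrary: x rule: finite_induct)
    case empty
    then have "x = \<zero>\<^bsub>T\<^esub>" by (intro T_eqI) (auto simp: T_extensional T_apply)
    then show ?case using zero by simp
  next
    case (insert k S)
    \<comment> \<open>The finite set \<open>S\<close> may contain the index 0, which supports never
      do; that index is simply dropped.\<close>
    show ?case
    proof (cases "k \<ge> 1")
      case False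
      then have "supp x \<subseteq> S" using insert.prems(2) by auto
      then show ?thesis using insert.IH insert.prems by blast
    next
      case True
      \<comment> \<open>Removing the component of degree \<open>k\<close> leaves an element
        supported in \<open>S\<close>; that component is restored through
        \<open>single\<close>.\<close>
      define y where "y = x(k := \<zero>\<^bsub>TP k\<^esub>)"
      have sub: "supp y \<subseteq> supp x - {k}" by (auto simp: y_def)
      have y: "y \<in> carrier T" unfolding T_carrier_iff
      proof (intro conjI allI impI)
        show "y \<in> extensional {1..}"
          using T_extensional(5)[OF insert.prems(1)] True by (auto simp: y_def extensional_def)
        show "y j \<in> carrier (TP j)" if "1 \<le> j" for j
          using T_coeff[OF insert.prems(1) that] abelian_groupE(2)[OF TP_abelian_group] by (simp add: y_def)
        have "finite (supp x)" using insert.prems(1) unfolding T_carrier_iff by blast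
        then show "finite (supp y)" using finite_subset[OF sub] by blast
      qed
      have xk: "x k \<in> carrier (TP k)" using insert.prems(1) True by (rule T_coeff)
      have "supp y \<subseteq> S" using sub insert.prems(2) by blast
      then have "P y" using insert.IH[OF y] insert.prems(3) by blast
      then have "P (single k (x k) \<oplus>\<^bsub>T\<^esub> y)"
        using single[OF xk True] insert.prems(3) xk y by (intro add single_closed) auto
      also have "single k (x k) \<oplus>\<^bsub>T\<^esub> y = x"
      proof (rule T_eqI)
        fix j :: nat assume j: "j \<ge> 1"
        note mon = abelian_group.axioms(1)[OF TP_abelian_group]
        show "(single k (x k) \<oplus>\<^bsub>T\<^esub> y) j = x j"
          using j T_coeff[OF insert.prems(1) j]
          by (cases "j = k")
            (simp_all add: T_apply single_def y_def abelian_monoid.r_zero[OF mon] abelian_monoid.l_zero[OF mon])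
      qed (use insert.prems(1) in \<open>auto simp: T_extensional\<close>)
      finally show ?thesis .
    qed
  qed
  from this[of "supp x" x] show ?thesis using x D by (auto simp: T_carrier_iff)
qed

text \<open>Universal property of T(A) as a vector space: \<open>\<phi>\<close>, linear in each
  letter, gives one linear map on every tensor power, and these are summed over the finite support
  of a family.\<close>

lemma tensor_algebra_lift:
  assumes W: "module K W"
    and \<phi>: "\<And>w. w \<noteq> [] \<Longrightarrow> set w \<subseteq> carrier A \<Longrightarrow> \<phi> w \<in> carrier W"
    and add: "\<And>u a b v. set (u @ a # b # v) \<subseteq> carrier A \<Longrightarrow>
        \<phi> (u @ (a \<oplus>\<^bsub>A\<^esub> b) # v) = \<phi> (u @ a # v) \<oplus>\<^bsub>W\<^esub> \<phi> (u @ b # v)"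
    and smult: "\<And>u a c v. set (u @ a # v) \<subseteq> carrier A \<Longrightarrow> c \<in> carrier K \<Longrightarrow>
        \<phi> (u @ (c \<odot>\<^bsub>A\<^esub> a) # v) = c \<odot>\<^bsub>W\<^esub> \<phi> (u @ a # v)"
  obtains g where "g \<in> linear_maps K T W"
    and "\<And>w. w \<noteq> [] \<Longrightarrow> set w \<subseteq> carrier A \<Longrightarrow> g (tensor_inj K A w) = \<phi> w"
proof -
  interpret W: module K W by fact
  have "\<exists>h. h \<in> linear_maps K (TP k) W \<and> (\<forall>w\<in>words A k. h (pure_tensor K A w) = \<phi> w)"
    if k: "k \<ge> 1" for k
  proof -
    have "\<phi> w \<in> carrier W" if "w \<in> words A k" for w
      using that k by (intro \<phi>) (auto simp: words_iff)
    moreover have "\<phi> (u @ (a \<oplus>\<^bsub>A\<^esub> b) # v) = \<phi> (u @ a # v) \<oplus>\<^bsub>W\<^esub> \<phi> (u @ b # v)"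
      if "u @ a # v \<in> words A k" "u @ b # v \<in> words A k" for u a b v
      using that by (intro add) (auto simp: words_iff)
    moreover have "\<phi> (u @ (c \<odot>\<^bsub>A\<^esub> a) # v) = c \<odot>\<^bsub>W\<^esub> \<phi> (u @ a # v)"
      if "u @ a # v \<in> words A k" "c \<in> carrier K" for u a c v
      using that by (intro smult) (auto simp: words_iff)
    ultimately show ?thesis by (rule tensor_power_lift[OF W, where k = k and \<phi> = \<phi>]) (assumption | blast)+
  qed
  then obtain h where h: "\<And>k. k \<ge> 1 \<Longrightarrow> h k \<in> linear_maps K (TP k) W"
      "\<And>k w. k \<ge> 1 \<Longrightarrow> w \<in> words A k \<Longrightarrow> h k (pure_tensor K A w) = \<phi> w"
    by metis
  define g where "g = (\<lambda>x. \<Oplus>\<^bsub>W\<^esub>k\<in>supp x. h k (x k))"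
  have closed: "h k (x k) \<in> carrier W" if "x \<in> carrier T" "k \<ge> 1" for x k
    using linear_maps_closed[OF h(1)] T_coeff that by blast
  have g: "g x = (\<Oplus>\<^bsub>W\<^esub>k\<in>S. h k (x k))"
    if "x \<in> carrier T" "finite S" "supp x \<subseteq> S" "S \<subseteq> {1..}" for x S
    unfolding g_def using that closed linear_maps_zero[OF TP_module W h(1)]
    by (intro W.add.finprod_mono_neutral_cong_left) (auto simp: subset_iff)
  have lin: "g \<in> linear_maps K T W"
  proof (rule linear_mapsI)
    fix x assume x: "x \<in> carrier T"
    then show "g x \<in> carrier W" unfolding g_def using closed by (intro W.M.finsum_closed) auto
    fix y assume y: "y \<in> carrier T"
    \<comment> \<open>A common index set for all three evaluations of \<open>g\<close>; including
      the support of the sum makes each containment immediate.\<close>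
    let ?S = "supp x \<union> supp y \<union> supp (x \<oplus>\<^bsub>T\<^esub> y)"
    have S: "finite ?S" "?S \<subseteq> {1..}" using x y T_add_closed[OF x y] by (auto simp: T_carrier_iff)
    have "g (x \<oplus>\<^bsub>T\<^esub> y) = (\<Oplus>\<^bsub>W\<^esub>k\<in>?S. h k ((x \<oplus>\<^bsub>T\<^esub> y) k))"
      by (rule g[OF T_add_closed[OF x y] S(1) _ S(2)]) auto
    also have "\<dots> = (\<Oplus>\<^bsub>W\<^esub>k\<in>?S. h k (x k) \<oplus>\<^bsub>W\<^esub> h k (y k))"
      using x y closed by (intro W.M.finsum_cong')
        (auto simp: T_apply linear_maps_add[OF h(1)] T_coeff)
    also have "\<dots> = (\<Oplus>\<^bsub>W\<^esub>k\<in>?S. h k (x k)) \<oplus>\<^bsub>W\<^esub> (\<Oplus>\<^bsub>W\<^esub>k\<in>?S. h k (y k))"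
      using x y closed by (intro W.M.finsum_addf) auto
    also have "(\<Oplus>\<^bsub>W\<^esub>k\<in>?S. h k (x k)) = g x"
      by (rule g[OF x S(1) _ S(2), symmetric]) auto
    also have "(\<Oplus>\<^bsub>W\<^esub>k\<in>?S. h k (y k)) = g y"
      by (rule g[OF y S(1) _ S(2), symmetric]) auto
    finally show "g (x \<oplus>\<^bsub>T\<^esub> y) = g x \<oplus>\<^bsub>W\<^esub> g y" .
  next
    fix c x assume c: "c \<in> carrier K" and x: "x \<in> carrier T"
    have S: "finite (supp x)" "supp x \<subseteq> {1..}" using x by (auto simp: T_carrier_iff)
    have "supp (c \<odot>\<^bsub>T\<^esub> x) \<subseteq> supp x"
      using module.smult_r_null[OF TP_module c] by (auto simp: T_apply)
    then have "g (c \<odot>\<^bsub>T\<^esub> x) = (\<Oplus>\<^bsub>W\<^esub>k\<in>supp x. h k ((c \<odot>\<^bsub>T\<^esub> x) k))"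
      using g[OF T_smult_closed[OF c x] S(1) _ S(2)] by blast
    also have "\<dots> = (\<Oplus>\<^bsub>W\<^esub>k\<in>supp x. c \<odot>\<^bsub>W\<^esub> h k (x k))"
      using c x closed by (intro W.M.finsum_cong')
        (auto simp: T_apply linear_maps_smult[OF h(1)] T_coeff)
    also have "\<dots> = c \<odot>\<^bsub>W\<^esub> g x"
      unfolding g_def using c x S closed by (intro W.finsum_smult_ldistr[symmetric]) auto
    finally show "g (c \<odot>\<^bsub>T\<^esub> x) = c \<odot>\<^bsub>W\<^esub> g x" .
  qed
  have "g (tensor_inj K A w) = \<phi> w" if w: "w \<noteq> []" "set w \<subseteq> carrier A" for w
  proof -
    have len: "length w \<ge> 1" using w by (cases w) auto
    then have "g (tensor_inj K A w) = (\<Oplus>\<^bsub>W\<^esub>k\<in>{length w}. h k (tensor_inj K A w k))"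
      using w by (intro g tensor_inj_closed) (auto simp: tensor_inj_def)
    also have "\<dots> = \<phi> w"
      using w len h(2)[of "length w" w] \<phi>[of w] by (simp add: tensor_inj_def words_iff)
    finally show ?thesis .
  qed
  then show ?thesis using lin that by blast
qed

text \<open>Both sides are bilinear in \<open>x\<close> and \<open>y\<close>, so agreement on pairs
  of words suffices. The spanning induction is run twice: over \<open>y\<close> with the left factor
  a fixed word, then over \<open>x\<close>.\<close>

lemma tensor_algebra_lift_mult:
  assumes W: "assoc_algebra K W" and g: "g \<in> linear_maps K T W"
    and uv: "\<And>u v. u \<noteq> [] \<Longrightarrow> v \<noteq> [] \<Longrightarrow> set u \<subseteq> carrier A \<Longrightarrow> set v \<subseteq> carrier A \<Longrightarrow>
      g (tensor_inj K A (u @ v)) = g (tensor_inj K A u) \<otimes>\<^bsub>W\<^esub> g (tensor_inj K A v)"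
    and x: "x \<in> carrier T" and y: "y \<in> carrier T"
  shows "g (x \<otimes>\<^bsub>T\<^esub> y) = g x \<otimes>\<^bsub>W\<^esub> g y"
proof -
  interpret W: assoc_algebra K W by fact
  interpret T: module K T by (rule T_module)
  note gm = linear_maps_closed[OF g] and ga = linear_maps_add[OF g] and gs = linear_maps_smult[OF g]
    and g0 = linear_maps_zero[OF T_module W.module_axioms g]
  note TL = T_mult_linear_left and TR = T_mult_linear_right
  note WL = bilinear_mult_left[OF W.bilinear_mult] and WR = bilinear_mult_right[OF W.bilinear_mult]
  note T0 = linear_maps_zero[OF T_module T_module] and W0 = linear_maps_zero[OF W.module_axioms W.module_axioms]
  have *: "g (tensor_inj K A u \<otimes>\<^bsub>T\<^esub> y) = g (tensor_inj K A u) \<otimes>\<^bsub>W\<^esub> g y"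
    if u: "u \<noteq> []" "set u \<subseteq> carrier A" for u
    using y subset_UNIV
  proof (induction rule: tensor_algebra_induct[where D = UNIV])
    case zero
    show ?case using T0[OF TR[OF tensor_inj_closed[OF u(2)]]] W0[OF WR[OF gm[OF tensor_inj_closed[OF u(2)]]]]
      by (simp add: g0)
  next
    case (inj w)
    then show ?case using u by (simp add: tensor_inj_mult uv)
  next
    case (add x y)
    then show ?case using tensor_inj_closed[OF u(2)]
      by (simp add: linear_maps_add[OF TR] linear_maps_add[OF WR] ga gm T_mult_closed)
  next
    case (smult c x)
    then show ?case using tensor_inj_closed[OF u(2)]
      by (simp add: linear_maps_smult[OF TR] linear_maps_smult[OF WR] gs gm T_mult_closed)
  qed
  show ?thesis
    using x subset_UNIV
  proof (induction rule: tensor_algebra_induct[where D = UNIV])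
    case zero
    show ?case using T0[OF TL[OF y]] W0[OF WL[OF gm[OF y]]] by (simp add: g0)
  next
    case (inj w)
    then show ?case using * by simp
  next
    case (add x x')
    then show ?case using y
      by (simp add: linear_maps_add[OF TL] linear_maps_add[OF WL] ga gm T_mult_closed)
  next
    case (smult c x)
    then show ?case using y
      by (simp add: linear_maps_smult[OF TL] linear_maps_smult[OF WL] gs gm T_mult_closed)
  qed
qed

text \<open>A nonempty word is the product of its first letter and the remaining word, so agreement
  on letters spreads to words by induction and to everything else by linearity.\<close>

lemma tensor_algebra_hom_eqI:
  assumes f: "f \<in> linear_maps K T W" and g: "g \<in> linear_maps K T W"
    and W: "module K W"
    and fm: "\<And>x y. x \<in> carrier T \<Longrightarrow> y \<in> carrier T \<Longrightarrow> f (x \<otimes>\<^bsub>T\<^esub> y) = f x \<otimes>\<^bsub>W\<^esub> f y"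
    and gm: "\<And>x y. x \<in> carrier T \<Longrightarrow> y \<in> carrier T \<Longrightarrow> g (x \<otimes>\<^bsub>T\<^esub> y) = g x \<otimes>\<^bsub>W\<^esub> g y"
    and eq: "\<And>a. a \<in> carrier A \<Longrightarrow> f (tensor_inj K A [a]) = g (tensor_inj K A [a])"
    and x: "x \<in> carrier T"
  shows "f x = g x"
  using x subset_UNIV
proof (induction rule: tensor_algebra_induct[where D = UNIV])
  case zero
  show ?case using linear_maps_zero[OF T_module W f] linear_maps_zero[OF T_module W g] by simp
next
  case (inj w)
  then show ?case
  proof (induction w rule: list_nonempty_induct)
    case (single a)
    then show ?case using eq by simp
  next
    case (cons a w)
    then have "tensor_inj K A (a # w) = tensor_inj K A [a] \<otimes>\<^bsub>T\<^esub> tensor_inj K A w"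
      using tensor_inj_mult[of "[a]" w] by simp
    then show ?case using cons eq by (simp add: fm gm tensor_inj_closed)
  qed
next
  case (add x y)
  then show ?case by (simp add: linear_maps_add[OF f] linear_maps_add[OF g])
next
  case (smult c x)
  then show ?case by (simp add: linear_maps_smult[OF f] linear_maps_smult[OF g])
qed

end


section \<open>Products of lists\<close>

lemma fold_mult_singleton: "fold_mult M [x] = x"
  by (simp add: fold_mult_def)

lemma fold_mult_Cons: "w \<noteq> [] \<Longrightarrow> fold_mult M (x # w) = x \<otimes>\<^bsub>M\<^esub> fold_mult M w"
  by (simp add: fold_mult_def)

context assoc_algebra
begin

lemma fold_mult_closed: "w \<noteq> [] \<Longrightarrow> set w \<subseteq> carrier M \<Longrightarrow> fold_mult M w \<in> carrier M"
  by (induction w rule: list_nonempty_induct)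
    (auto simp: fold_mult_singleton fold_mult_Cons alg_mult_closed)

lemma fold_mult_append:
  assumes "u \<noteq> []" "v \<noteq> []" "set u \<subseteq> carrier M" "set v \<subseteq> carrier M"
  shows "fold_mult M (u @ v) = fold_mult M u \<otimes>\<^bsub>M\<^esub> fold_mult M v"
  using assms by (induction u rule: list_nonempty_induct)
    (auto simp: fold_mult_singleton fold_mult_Cons fold_mult_closed alg_mult_assoc)

text \<open>Varying one factor of a product composes left multiplications by the letters of
  \<open>u\<close> with right multiplication by the product of \<open>v\<close>. An empty
  \<open>v\<close> is treated apart, since without a unit it has no product; the map is then the
  identity.\<close>

lemma fold_mult_linear:
  assumes "set u \<subseteq> carrier M" "set v \<subseteq> carrier M"
  shows "(\<lambda>x. fold_mult M (u @ x # v)) \<in> linear_maps K M M"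
  using assms
proof (induction u)
  case Nil
  show ?case
  proof (cases "v = []")
    case True
    then show ?thesis by (auto simp: fold_mult_singleton intro: linear_mapsI)
  next
    case False
    then show ?thesis
      using Nil bilinear_mult_left[OF bilinear_mult fold_mult_closed[of v]] by (simp add: fold_mult_Cons)
  qed
next
  case (Cons y u)
  then show ?case
    using linear_maps_compose[OF _ bilinear_mult_right[OF bilinear_mult, of y]]
    by (simp add: fold_mult_Cons)
qed

end


section \<open>The enveloping algebra\<close>

text \<open>Each factor contributes degree one, and addition in
  \<open>integer_mod_group (n - 1)\<close> reduces in the same way as \<open>Z_class\<close>, so the
  degree counts factors modulo n - 1.\<close>

lemma fold_mult_graded:
  assumes gr: "graded_algebra K (integer_mod_group (n - 1)) M gr"
    and w: "w \<noteq> []" "set w \<subseteq> gr (Z_class n 1)"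
  shows "fold_mult M w \<in> gr (Z_class n (length w))"
  using w
proof (induction w rule: list_nonempty_induct)
  case (single x)
  then show ?case by (simp add: fold_mult_singleton)
next
  case (cons x w)
  have "Z_class n k \<in> carrier (integer_mod_group (n - 1))" for k
    by (auto simp: Z_class_def carrier_integer_mod_group)
  moreover have "Z_class n 1 \<otimes>\<^bsub>integer_mod_group (n - 1)\<^esub> Z_class n k = Z_class n (Suc k)" for k
    by (auto simp: Z_class_def mod_add_eq)
  moreover have "\<forall>g\<in>carrier (integer_mod_group (n - 1)). \<forall>h\<in>carrier (integer_mod_group (n - 1)).
      \<forall>x\<in>gr g. \<forall>y\<in>gr h. x \<otimes>\<^bsub>M\<^esub> y \<in> gr (g \<otimes>\<^bsub>integer_mod_group (n - 1)\<^esub> h)"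
    using gr unfolding graded_algebra_def by blast
  ultimately have "x \<otimes>\<^bsub>M\<^esub> y \<in> gr (Z_class n (Suc k))" if "x \<in> gr (Z_class n 1)" "y \<in> gr (Z_class n k)" for x y k
    using that by metis
  then show ?case using cons by (simp add: fold_mult_Cons)
qed

text \<open>On words the bracket is the value of a linear map from the tensor power into
  \<open>A\<close>, which forces it back into the carrier.\<close>

lemma nary_algebra_closed: "nary_algebra K n A br \<Longrightarrow> w \<in> words A n \<Longrightarrow> br w \<in> carrier A"
proof -
  assume *: "nary_algebra K n A br" and w: "w \<in> words A n"
  interpret tensors K A using * by (simp add: nary_algebra_def tensors_def)
  show ?thesis using * linear_maps_closed[OF _ pure_tensor_closed[OF w]] w
    by (auto simp: nary_algebra_def)
qed

text \<open>Positivity of \<open>n\<close> keeps the words in the generators nonempty, as T(A)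
  starts in degree one.\<close>

locale enveloping = tensors +
  fixes n :: nat and br :: "'c list \<Rightarrow> 'c"
  assumes n: "n > 0" and nary: "nary_algebra K n A br"
begin

abbreviation I where "I \<equiv> env_ideal K n A br"
abbreviation E where "E \<equiv> env_algebra K n A br"
abbreviation proj where "proj \<equiv> env_proj K n A br"

lemma words_nonempty: "w \<in> words A n \<Longrightarrow> w \<noteq> [] \<and> set w \<subseteq> carrier A"
  using n by (auto simp: words_iff)

lemma relator_closed:
  assumes w: "w \<in> words A n"
  shows "tensor_inj K A w \<ominus>\<^bsub>T\<^esub> tensor_inj K A [br w] \<in> carrier T"
proof -
  interpret T: module K T by (rule T_module)
  show ?thesis using words_nonempty[OF w] nary_algebra_closed[OF nary w]
    by (intro T.M.minus_closed tensor_inj_closed) auto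
qed

lemma I_ideal: "alg_ideal K T I"
  unfolding env_ideal_def
  by (rule gen_alg_ideal_is_ideal[OF T_module T_bilinear_mult]) (use relator_closed in auto)

lemma I_quotient: "quotient K T I"
  using I_ideal by (intro quotientI T_module) (simp add: alg_ideal_def)

lemma E_carrier: "carrier E = proj ` carrier T"
  unfolding env_algebra_def env_proj_def by (rule quotient.quot_carrier[OF I_quotient])

lemma E_module: "module K E"
  unfolding env_algebra_def by (rule quotient.quot_is_module[OF I_quotient])

lemma proj_linear: "proj \<in> linear_maps K T E"
  unfolding env_algebra_def env_proj_def by (rule quotient.quot_proj_linear[OF I_quotient])

lemma proj_mult: "x \<in> carrier T \<Longrightarrow> y \<in> carrier T \<Longrightarrow> proj x \<otimes>\<^bsub>E\<^esub> proj y = proj (x \<otimes>\<^bsub>T\<^esub> y)"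
  unfolding env_algebra_def env_proj_def by (rule quot_mult[OF T_module T_bilinear_mult I_ideal])

lemma E_mult_closed: "x \<in> carrier E \<Longrightarrow> y \<in> carrier E \<Longrightarrow> x \<otimes>\<^bsub>E\<^esub> y \<in> carrier E"
  by (auto simp: E_carrier proj_mult T_mult_closed)

section \<open>Uniqueness and existence of the extension to the enveloping algebra\<close>

lemma env_grading_subset: "env_grading K n A br d \<subseteq> carrier E"
  by (auto simp: env_grading_def tensor_grading_def E_carrier)

text \<open>Uniqueness of a total function requires fixed values off the carrier. Discarding the old
  ones is harmless because sums, multiples, products and homogeneous parts stay in the
  carrier.\<close>

lemma graded_alg_homs_restrict:
  assumes f: "f \<in> graded_alg_homs K G E (env_grading K n A br) M gr"
  shows "restrict f (carrier E) \<in> graded_alg_homs K G E (env_grading K n A br) M gr"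
proof -
  interpret E: module K E by (rule E_module)
  have "restrict f (carrier E) ` env_grading K n A br d = f ` env_grading K n A br d" for d
    using env_grading_subset[of d] by (intro image_cong) auto
  then show ?thesis
    using f by (auto simp: graded_alg_homs_def linear_maps_def E_mult_closed)
qed

text \<open>Both maps are pulled back along the surjection \<open>proj\<close> to multiplicative
  maps on T(A), where the letters decide.\<close>

lemma graded_alg_homs_eqI:
  assumes f: "f \<in> graded_alg_homs K G E gr M gr'" and g: "g \<in> graded_alg_homs K G E gr M gr'"
    and M: "module K M"
    and eq: "\<And>a. a \<in> carrier A \<Longrightarrow> f (env_incl K n A br a) = g (env_incl K n A br a)"
    and x: "x \<in> carrier E"
  shows "f x = g x"
proof -
  have lin: "f \<in> linear_maps K E M" "g \<in> linear_maps K E M"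
    and mult: "\<And>x y. x \<in> carrier E \<Longrightarrow> y \<in> carrier E \<Longrightarrow> f (x \<otimes>\<^bsub>E\<^esub> y) = f x \<otimes>\<^bsub>M\<^esub> f y"
      "\<And>x y. x \<in> carrier E \<Longrightarrow> y \<in> carrier E \<Longrightarrow> g (x \<otimes>\<^bsub>E\<^esub> y) = g x \<otimes>\<^bsub>M\<^esub> g y"
    using f g by (auto simp: graded_alg_homs_def)
  obtain t where t: "t \<in> carrier T" "x = proj t" using x by (auto simp: E_carrier)
  have "f (proj t) = g (proj t)"
  proof (rule tensor_algebra_hom_eqI[OF linear_maps_compose[OF proj_linear lin(1)]
        linear_maps_compose[OF proj_linear lin(2)] M _ _ _ t(1)])
    show "f (proj (tensor_inj K A [a])) = g (proj (tensor_inj K A [a]))" if "a \<in> carrier A" for a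
      using eq[OF that] by (simp add: env_incl_def)
  qed (use linear_maps_closed[OF proj_linear] in \<open>simp_all add: proj_mult[symmetric] mult\<close>)
  then show ?thesis using t by simp
qed

lemma graded_alg_homs_exist:
  assumes gr: "graded_algebra K (integer_mod_group (n - 1)) M gr"
    and \<rho>: "\<rho> \<in> nary_homs K n A br (M\<lparr>carrier := gr (Z_class n 1)\<rparr>) (fold_mult M)"
  obtains f where
    "f \<in> graded_alg_homs K (integer_mod_group (n - 1)) E (env_grading K n A br) M gr"
    and "\<And>a. a \<in> carrier A \<Longrightarrow> f (env_incl K n A br a) = \<rho> a"
proof -
  interpret M: assoc_algebra K M using gr by (simp add: graded_algebra_def)
  have sub: "submodule (gr g) K M" if "g \<in> carrier (integer_mod_group (n - 1))" for g
    using gr that by (simp add: graded_algebra_def)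
  have one: "Z_class n 1 \<in> carrier (integer_mod_group (n - 1))"
    by (auto simp: Z_class_def carrier_integer_mod_group)
  \<comment> \<open>Shrinking the carrier leaves the operations of \<open>M\<close> in place, so
    linearity into the degree-one part supplies both equations in \<open>M\<close> and membership in
    degree one.\<close>
  have lin1: "\<rho> \<in> linear_maps K A (M\<lparr>carrier := gr (Z_class n 1)\<rparr>)"
    and br: "\<And>w. w \<in> words A n \<Longrightarrow> \<rho> (br w) = fold_mult M (map \<rho> w)"
    using \<rho> by (auto simp: nary_homs_def)
  have deg: "\<rho> a \<in> gr (Z_class n 1)" if "a \<in> carrier A" for a
    using linear_maps_closed[OF lin1 that] by simp
  then have clo: "\<rho> a \<in> carrier M" if "a \<in> carrier A" for a
    using that M.submoduleE(1)[OF sub[OF one]] by blast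
  have \<rho>_add: "\<rho> (a \<oplus>\<^bsub>A\<^esub> b) = \<rho> a \<oplus>\<^bsub>M\<^esub> \<rho> b" if "a \<in> carrier A" "b \<in> carrier A" for a b
    using linear_maps_add[OF lin1 that] by simp
  have \<rho>_smult: "\<rho> (c \<odot>\<^bsub>A\<^esub> a) = c \<odot>\<^bsub>M\<^esub> \<rho> a" if "c \<in> carrier K" "a \<in> carrier A" for a c
    using linear_maps_smult[OF lin1 that] by simp
  define \<phi> where "\<phi> w = fold_mult M (map \<rho> w)" for w
  have map: "set (map \<rho> w) \<subseteq> carrier M" if "set w \<subseteq> carrier A" for w
    using clo that by auto
  have closed: "\<phi> w \<in> carrier M" if "w \<noteq> []" "set w \<subseteq> carrier A" for w
    unfolding \<phi>_def using that map by (intro M.fold_mult_closed) auto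
  have add: "\<phi> (u @ (a \<oplus>\<^bsub>A\<^esub> b) # v) = \<phi> (u @ a # v) \<oplus>\<^bsub>M\<^esub> \<phi> (u @ b # v)"
    if "set (u @ a # b # v) \<subseteq> carrier A" for u a b v
    using that linear_maps_add[OF M.fold_mult_linear[OF map map], of u v "\<rho> a" "\<rho> b"]
    by (simp add: \<phi>_def \<rho>_add clo)
  have smult: "\<phi> (u @ (c \<odot>\<^bsub>A\<^esub> a) # v) = c \<odot>\<^bsub>M\<^esub> \<phi> (u @ a # v)"
    if "set (u @ a # v) \<subseteq> carrier A" "c \<in> carrier K" for u a c v
    using that linear_maps_smult[OF M.fold_mult_linear[OF map map], of u v c "\<rho> a"]
    by (simp add: \<phi>_def \<rho>_smult clo)
  obtain g where g: "g \<in> linear_maps K T M"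
    and g\<phi>: "\<And>w. w \<noteq> [] \<Longrightarrow> set w \<subseteq> carrier A \<Longrightarrow> g (tensor_inj K A w) = \<phi> w"
    using tensor_algebra_lift[OF M.module_axioms closed add smult] by blast
  have gm: "g (x \<otimes>\<^bsub>T\<^esub> y) = g x \<otimes>\<^bsub>M\<^esub> g y" if "x \<in> carrier T" "y \<in> carrier T" for x y
  proof (rule tensor_algebra_lift_mult[OF M.assoc_algebra_axioms g _ that])
    fix u v assume uv: "u \<noteq> []" "v \<noteq> []" "set u \<subseteq> carrier A" "set v \<subseteq> carrier A"
    then show "g (tensor_inj K A (u @ v)) = g (tensor_inj K A u) \<otimes>\<^bsub>M\<^esub> g (tensor_inj K A v)"
      using M.fold_mult_append[OF _ _ map map, of u v] by (simp add: g\<phi>) (simp add: \<phi>_def)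
  qed
  \<comment> \<open>The spanning induction is run with \<open>D\<close> the set of lengths of class
    \<open>d\<close>: words of these lengths land in \<open>gr d\<close>, and linear combinations
    remain there because \<open>gr d\<close> is a subspace.\<close>
  have gdeg: "g x \<in> gr d" if d: "d \<in> carrier (integer_mod_group (n - 1))"
    and x: "x \<in> tensor_grading K n A d" for x d
  proof -
    have xT: "x \<in> carrier T" and xd: "supp x \<subseteq> {k. Z_class n k = d}"
      using x by (auto simp: tensor_grading_def)
    note S = sub[OF d]
    from xT xd show ?thesis
    proof (induction rule: tensor_algebra_induct)
      case zero
      then show ?case using M.submodule_zero[OF S] linear_maps_zero[OF T_module M.module_axioms g] by simp
    next
      case (inj w)
      then have "set (map \<rho> w) \<subseteq> gr (Z_class n 1)" using deg by auto
      then show ?case using inj fold_mult_graded[OF gr, of "map \<rho> w"] by (simp add: g\<phi>) (simp add: \<phi>_def)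
    next
      case (add x y)
      then show ?case using M.submoduleE(5)[OF S] by (simp add: linear_maps_add[OF g])
    next
      case (smult c x)
      then show ?case using M.submoduleE(4)[OF S] by (simp add: linear_maps_smult[OF g])
    qed
  qed
  \<comment> \<open>Once the kernel is known to be an ideal, minimality reduces vanishing on
    \<open>I\<close> to vanishing on its generators.\<close>
  have "alg_ideal K T {x \<in> carrier T. g x \<in> {\<zero>\<^bsub>M\<^esub>}}"
    by (rule alg_ideal_kernel[OF T_module T_bilinear_mult M.assoc_algebra_axioms g]) (rule gm)
  then have "I \<subseteq> {x \<in> carrier T. g x \<in> {\<zero>\<^bsub>M\<^esub>}}"
    unfolding env_ideal_def
  proof (rule gen_alg_ideal_least)
    have "g (tensor_inj K A w \<ominus>\<^bsub>T\<^esub> tensor_inj K A [br w]) = \<zero>\<^bsub>M\<^esub>" if w: "w \<in> words A n" for w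
    proof -
      have w': "w \<noteq> []" "set w \<subseteq> carrier A" "br w \<in> carrier A"
        using words_nonempty[OF w] nary_algebra_closed[OF nary w] by auto
      have "\<phi> [br w] = \<phi> w" by (simp add: \<phi>_def fold_mult_singleton br[OF w])
      then show ?thesis
        using w' closed[of w] M.M.minus_eq_zero_iff[of "\<phi> w" "\<phi> w"]
        by (simp add: linear_maps_minus[OF T_module M.module_axioms g] tensor_inj_closed g\<phi>)
    qed
    then show "{tensor_inj K A w \<ominus>\<^bsub>T\<^esub> tensor_inj K A [br w] | w. w \<in> words A n}
        \<subseteq> {x \<in> carrier T. g x \<in> {\<zero>\<^bsub>M\<^esub>}}"
      using relator_closed by auto
  qed
  then obtain f where f: "f \<in> linear_maps K E M" "\<And>x. x \<in> carrier T \<Longrightarrow> f (proj x) = g x"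
    using quotient.quot_lift[OF I_quotient M.module_axioms g]
    unfolding env_algebra_def env_proj_def by blast
  have "f \<in> graded_alg_homs K (integer_mod_group (n - 1)) E (env_grading K n A br) M gr"
    unfolding graded_alg_homs_def
  proof (intro CollectI conjI ballI f(1))
    fix X Y assume "X \<in> carrier E" "Y \<in> carrier E"
    then show "f (X \<otimes>\<^bsub>E\<^esub> Y) = f X \<otimes>\<^bsub>M\<^esub> f Y"
      by (auto simp: E_carrier proj_mult T_mult_closed f(2) gm)
  next
    fix d assume "d \<in> carrier (integer_mod_group (n - 1))"
    then show "f ` env_grading K n A br d \<subseteq> gr d"
      using gdeg by (auto simp: env_grading_def f(2) tensor_grading_def)
  qed
  moreover have "f (env_incl K n A br a) = \<rho> a" if "a \<in> carrier A" for a
    using that by (simp add: env_incl_def f(2) tensor_inj_closed g\<phi>) (simp add: \<phi>_def fold_mult_singleton)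
  ultimately show ?thesis using that by blast
qed

end

theorem mainTheorem3:
  fixes K :: "('k, 'x) ring_scheme"
    and A :: "('k, 'a, 'y) module_scheme"
    and M :: "('k, 'm, 'z) module_scheme"
    and br :: "'a list \<Rightarrow> 'a" and gr :: "int \<Rightarrow> 'm set" and \<rho> :: "'a \<Rightarrow> 'm" and n :: nat
  assumes "n \<ge> 2"
    and "field K"
    and "nary_algebra K n A br"
    and "graded_algebra K (integer_mod_group (n - 1)) M gr"
    and "\<rho> \<in> nary_homs K n A br (M\<lparr>carrier := gr (Z_class n 1)\<rparr>) (fold_mult M)"
  shows "\<exists>!\<rho>'. \<rho>' \<in> extensional (carrier (env_algebra K n A br)) \<and>
      \<rho>' \<in> graded_alg_homs K (integer_mod_group (n - 1))
              (env_algebra K n A br) (env_grading K n A br) M gr \<and>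
      (\<forall>a\<in>carrier A. \<rho>' (env_incl K n A br a) = \<rho> a)"
proof -
  interpret enveloping K A n br
    using assms(1,3) by (simp add: enveloping_def enveloping_axioms_def tensors_def nary_algebra_def)
  let ?H = "graded_alg_homs K (integer_mod_group (n - 1)) E (env_grading K n A br) M gr"
  obtain f where f: "f \<in> ?H" "\<And>a. a \<in> carrier A \<Longrightarrow> f (env_incl K n A br a) = \<rho> a"
    using graded_alg_homs_exist[OF assms(4,5)] by blast
  have M: "module K M"
    using assms(4) by (simp add: graded_algebra_def assoc_algebra_def)
  have incl: "env_incl K n A br a \<in> carrier E" if "a \<in> carrier A" for a
    using that by (auto simp: env_incl_def E_carrier tensor_inj_closed)
  show ?thesis
  \<comment> \<open>The witness is \<open>undefined\<close> off the carrier, hence extensional; any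
    competitor agrees with \<open>f\<close> on the carrier and is extensional too, so it is the same
    function.\<close>
  proof (intro ex1I[of _ "restrict f (carrier E)"] conjI ballI)
    show "restrict f (carrier E) \<in> ?H" using f(1) by (rule graded_alg_homs_restrict)
    fix h assume h: "h \<in> extensional (carrier E) \<and> h \<in> ?H \<and> (\<forall>a\<in>carrier A. h (env_incl K n A br a) = \<rho> a)"
    have "h x = f x" if "x \<in> carrier E" for x
      using h f(2) by (intro graded_alg_homs_eqI[OF _ f(1) M _ that]) auto
    then show "h = restrict f (carrier E)"
      using h by (intro extensionalityI[of h "carrier E"]) auto
  qed (use f(2) incl in auto)
qed

end
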